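(* For every fixed finite field $\mathbb{F}$, the problems $\#\mathrm{Rank}\text{-}\mathrm{Bases}$ and $\#\mathrm{Nullity}\text{-}\mathrm{Bases}$ are fixed-parameter tractable for matroids given by a linear representation over $\mathbb{F}$.
   Context: A matroid is given by a representing matrix over $\mathbb{F}$: columns indexed by the ground set $E$, a subset of $E$ being independent iff the corresponding columns are linearly independent. Bases are maximal independent sets; rank is their common size, nullity is $|E|$ minus the rank. $\#\mathrm{Rank}\text{-}\mathrm{Bases}$ (resp. $\#\mathrm{Nullity}\text{-}\mathrm{Bases}$) asks for the number of bases, parameterized by the rank (resp. nullity). Fixed-parameter tractable means computable in time $f(k)\cdot |x|^c$ for a computable $f$, constant $c$, parameter $k$ and input $x$. *)

theory Defs
  imports "Jordan_Normal_Form.VS_Connect"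
begin

text \<open>
  Machine model: structured programs for a random access machine whose cells hold natural
  numbers, with the uniform cost measure and only addition, truncated subtraction and halving as
  arithmetic. A step makes the largest number in the machine at most one bit longer, so this is
  polynomially equivalent to Turing machines (multiplication must not be added at unit cost).
  A state consists of the scalar registers and of the memory, which is split
  into separately addressed arrays. Register and array names are constants of the program, so
  each program uses finitely many of them; interleaving them into a single memory costs a
  constant factor.
\<close>

datatype com =
    Skip
  | Const nat nat
  | Copy nat nat
  | Add nat nat nat
  | Sub nat nat nat
  | Half nat nat
  | Load nat nat nat
  | Store nat nat nat
  | Seq com com  (infixr ";;" 60)
  | If_Nonzero nat com com
  | While_Nonzero nat com

type_synonym state = "(nat \<Rightarrow> nat) \<times> (nat \<Rightarrow> nat \<Rightarrow> nat)"

text \<open>\<open>exec p s t s'\<close>: started in \<open>s\<close>, program \<open>p\<close> halts in \<open>s'\<close> after exactly \<open>t\<close> steps.\<close>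

inductive exec :: "com \<Rightarrow> state \<Rightarrow> nat \<Rightarrow> state \<Rightarrow> bool" where
  Skip: "exec Skip s 1 s"
| Const: "exec (Const x n) (r, m) 1 (r(x := n), m)"
| Copy: "exec (Copy x y) (r, m) 1 (r(x := r y), m)"
| Add: "exec (Add x y z) (r, m) 1 (r(x := r y + r z), m)"
| Sub: "exec (Sub x y z) (r, m) 1 (r(x := r y - r z), m)"
| Half: "exec (Half x y) (r, m) 1 (r(x := r y div 2), m)"
| Load: "exec (Load x a y) (r, m) 1 (r(x := m a (r y)), m)"
| Store: "exec (Store a x y) (r, m) 1 (r, m(a := (m a)(r x := r y)))"
| Seq: "exec p s t s' \<Longrightarrow> exec q s' u s'' \<Longrightarrow> exec (p ;; q) s (t + u) s''"
| If_True: "fst s x \<noteq> 0 \<Longrightarrow> exec p s t s' \<Longrightarrow> exec (If_Nonzero x p q) s (t + 1) s'"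
| If_False: "fst s x = 0 \<Longrightarrow> exec q s t s' \<Longrightarrow> exec (If_Nonzero x p q) s (t + 1) s'"
| While_True: "fst s x \<noteq> 0 \<Longrightarrow> exec p s t s' \<Longrightarrow> exec (While_Nonzero x p) s' u s''
    \<Longrightarrow> exec (While_Nonzero x p) s (t + u + 1) s''"
| While_False: "fst s x = 0 \<Longrightarrow> exec (While_Nonzero x p) s 1 s"

inductive_cases exec_elims:
  "exec Skip s t s'" "exec (Const x n) s t s'" "exec (Copy x y) s t s'"
  "exec (Add x y z) s t s'" "exec (Sub x y z) s t s'" "exec (Half x y) s t s'"
  "exec (Load x a y) s t s'" "exec (Store a x y) s t s'"

inductive_cases exec_SeqE: "exec (p ;; q) s t s'"
inductive_cases exec_IfE: "exec (If_Nonzero x p q) s t s'"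
inductive_cases exec_WhileE: "exec (While_Nonzero x p) s t s'"

lemma exec_deterministic:
  "exec p s t s' \<Longrightarrow> exec p s u s'' \<Longrightarrow> u = t \<and> s'' = s'"
proof (induction p s t s' arbitrary: u s'' rule: exec.induct)
  case (Seq p s t s' q v s''')
  from Seq.prems show ?case
    by (rule exec_SeqE) (use Seq.IH in fast)
next
  case (If_True s x p t s' q)
  from If_True.prems show ?case
    by (rule exec_IfE) (use If_True.IH If_True.hyps(1) in auto)
next
  case (If_False s x q t s' p)
  from If_False.prems show ?case
    by (rule exec_IfE) (use If_False.IH If_False.hyps(1) in auto)
next
  case (While_True s x p t s' v s''')
  from While_True.prems show ?case
  proof (rule exec_WhileE)
    fix t1 s1 u1
    assume u: "u = Suc (t1 + u1)" and "exec p s t1 s1" and 2: "exec (While_Nonzero x p) s1 u1 s''"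
    then have 1: "t1 = t \<and> s1 = s'"
      by (intro While_True.IH(1))
    from 2 have "u1 = v \<and> s'' = s'''"
      unfolding conjunct2[OF 1] by (rule While_True.IH(2))
    with 1 u show ?case by simp
  qed (use While_True.hyps(1) in simp)
next
  case (While_False s x p)
  from While_False.prems show ?case
    by (rule exec_WhileE) (use While_False.hyps in auto)
qed (erule exec_elims, simp)+

text \<open>
  The input word is in array 0 and its length in register 0; all other cells are 0.
  The output is read from register 0.
\<close>

definition initial_state :: "nat list \<Rightarrow> state" where
  "initial_state w =
    ((\<lambda>x. if x = 0 then length w else 0),
     (\<lambda>a i. if a = 0 \<and> i < length w then w ! i else 0))"

definition computes_in_steps :: "com \<Rightarrow> nat list \<Rightarrow> nat \<Rightarrow> nat \<Rightarrow> bool" where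
  "computes_in_steps p w t y \<longleftrightarrow> (\<exists>s. exec p (initial_state w) t s \<and> fst s 0 = y)"

definition computable :: "(nat \<Rightarrow> nat) \<Rightarrow> bool" where
  "computable f \<longleftrightarrow> (\<exists>p. \<forall>k. \<exists>t. computes_in_steps p [k] t (f k))"

text \<open>
  The counting problem \<open>F\<close> on instances encoded by \<open>enc\<close> and parameterized by \<open>\<kappa>\<close>.
  The input size is the length of \<open>enc x\<close>, so \<open>enc\<close> has to produce words over one fixed finite
  alphabet. The program receives the word only, not the value of the parameter.
\<close>

definition fixed_parameter_tractable ::
    "('a \<Rightarrow> nat list) \<Rightarrow> ('a \<Rightarrow> nat) \<Rightarrow> ('a \<Rightarrow> nat) \<Rightarrow> bool" where
  "fixed_parameter_tractable enc \<kappa> F \<longleftrightarrow>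
    (\<exists>p f c. computable f \<and>
      (\<forall>x. \<exists>t. computes_in_steps p (enc x) t (F x) \<and> t \<le> f (\<kappa> x) * length (enc x) ^ c))"

text \<open>
  Matroids represented by a matrix. The ground set consists of the column indices. Linear
  independence of the columns is meant for the indexed family, so parallel elements given by
  equal columns are dependent; as \<open>lin_dep\<close> speaks about sets of vectors, injectivity is
  required separately.
\<close>

definition ground_set :: "'f::field mat \<Rightarrow> nat set" where
  "ground_set A = {..<dim_col A}"

definition matroid_indep :: "'f::field mat \<Rightarrow> nat set \<Rightarrow> bool" where
  "matroid_indep A S \<longleftrightarrow> S \<subseteq> ground_set A \<and> inj_on (col A) S \<and>
    \<not> module.lin_dep class_ring (module_vec TYPE('f) (dim_row A)) (col A ` S)"

definition matroid_bases :: "'f::field mat \<Rightarrow> nat set set" where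
  "matroid_bases A =
    {B. matroid_indep A B \<and> (\<forall>S. matroid_indep A S \<and> B \<subseteq> S \<longrightarrow> S = B)}"

definition matroid_rank :: "'f::field mat \<Rightarrow> nat" where
  "matroid_rank A = (THE r. \<forall>B\<in>matroid_bases A. card B = r)"

definition matroid_nullity :: "'f::field mat \<Rightarrow> nat" where
  "matroid_nullity A = card (ground_set A) - matroid_rank A"

definition num_bases :: "'f::field mat \<Rightarrow> nat" where
  "num_bases A = card (matroid_bases A)"

text \<open>
  For \<open>code\<close> mapping the field bijectively to \<open>{0..<q}\<close>, where \<open>q\<close> is its number of elements,
  this is an injective encoding of matrices by words over the alphabet \<open>{0..<q}\<close>: the dimensions
  in unary, each terminated by 0, and then the entries row by row.
\<close>

definition matrix_word :: "('f \<Rightarrow> nat) \<Rightarrow> 'f mat \<Rightarrow> nat list" where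
  "matrix_word code A =
    replicate (dim_row A) 1 @ [0] @ replicate (dim_col A) 1 @ [0] @
    concat (map (\<lambda>i. map (\<lambda>j. code (A $$ (i, j))) [0..<dim_col A]) [0..<dim_row A])"

end

theory Submission
  imports Defs "HOL-Library.Nat_Bijection"
begin

text \<open>
  An information set of a linear code with \<open>q ^ s\<close> words is a set of \<open>s\<close> positions on which
  only the zero word vanishes. The complements of the information sets
  of the kernel of a matrix are the bases of its matroid, and by duality these are the information
  sets of its row space. The kernel has \<open>q ^ nullity\<close> words and the row space \<open>q ^ rank\<close>.

  Both codes are read off one elimination: starting from the unit vectors, each row of the matrix
  discards one generator that is not orthogonal to it and corrects the others by a multiple of the
  discarded one. The remaining generators span the kernel, and the rows that discarded
  a generator form a basis of the row space.

  Information sets of a code given by the list of its \<open>Q\<close> words are counted by a dynamic program.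
  Its states are the sets of words that vanish on the positions chosen so far, at most \<open>2 ^ Q\<close> of
  them, and a position may be chosen only if it makes this set smaller. Hence the time is bounded
  by a polynomial in the input length times a power of \<open>2 ^ Q\<close>, where \<open>Q = q ^ k\<close> for the parameter \<open>k\<close>.
\<close>

section \<open>Weakest preconditions for the machine programs\<close>

text \<open>A dependency among columns is a nonzero kernel word whose support lists the columns
  involved, so a column set is independent iff only the zero word of the kernel vanishes off it.
  Both codes are needed because the other one can be far larger than the parameter allows: small
  rank leaves a huge kernel and small nullity a huge row space. Dimensions enter only as exponents
  of word counts, and each step multiplies or divides a count by \<open>q\<close>. The shrinking
  rule of the dynamic program is independence of positions in this counting form; hence the
  surviving words determine how many positions were chosen, and they form a complete state. The
  program is not told the parameter \<open>k\<close>: elimination yields an independent generating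
  set, and the list of words built from it has length \<open>q ^ k\<close> by itself. The running
  time has total degree three in the numbers of rows and columns, \<open>Q\<close> and
  \<open>2 ^ Q\<close>. This is the origin of the exponent 3 and of the bound
  \<open>C * 2 ^ (3 * q ^ k)\<close>.\<close>

definition wp :: "com \<Rightarrow> (nat \<Rightarrow> state \<Rightarrow> bool) \<Rightarrow> state \<Rightarrow> bool" where
  "wp p Q s \<longleftrightarrow> (\<exists>t s'. exec p s t s' \<and> Q t s')"

text \<open>Equations instead of introduction rules let the simplifier execute straight-line code
  symbolically and add up its steps.\<close>

lemma wp_basic [simp]:
  "wp Skip Q s = Q 1 s"
  "wp (Const x n) Q (r, m) = Q 1 (r(x := n), m)"
  "wp (Copy x y) Q (r, m) = Q 1 (r(x := r y), m)"
  "wp (Add x y z) Q (r, m) = Q 1 (r(x := r y + r z), m)"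
  "wp (Sub x y z) Q (r, m) = Q 1 (r(x := r y - r z), m)"
  "wp (Half x y) Q (r, m) = Q 1 (r(x := r y div 2), m)"
  "wp (Load x a y) Q (r, m) = Q 1 (r(x := m a (r y)), m)"
  "wp (Store a x y) Q (r, m) = Q 1 (r, m(a := (m a)(r x := r y)))"
proof -
  have iff: "\<And>t s'. exec Skip s t s' \<longleftrightarrow> t = 1 \<and> s' = s"
    "\<And>t s'. exec (Const x n) (r, m) t s' \<longleftrightarrow> t = 1 \<and> s' = (r(x := n), m)"
    "\<And>t s'. exec (Copy x y) (r, m) t s' \<longleftrightarrow> t = 1 \<and> s' = (r(x := r y), m)"
    "\<And>t s'. exec (Add x y z) (r, m) t s' \<longleftrightarrow> t = 1 \<and> s' = (r(x := r y + r z), m)"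
    "\<And>t s'. exec (Sub x y z) (r, m) t s' \<longleftrightarrow> t = 1 \<and> s' = (r(x := r y - r z), m)"
    "\<And>t s'. exec (Half x y) (r, m) t s' \<longleftrightarrow> t = 1 \<and> s' = (r(x := r y div 2), m)"
    "\<And>t s'. exec (Load x a y) (r, m) t s' \<longleftrightarrow> t = 1 \<and> s' = (r(x := m a (r y)), m)"
    "\<And>t s'. exec (Store a x y) (r, m) t s' \<longleftrightarrow> t = 1 \<and> s' = (r, m(a := (m a)(r x := r y)))"
    by (auto elim: exec_elims intro: exec.intros simp del: One_nat_def)
  show "wp Skip Q s = Q 1 s"
    "wp (Const x n) Q (r, m) = Q 1 (r(x := n), m)"
    "wp (Copy x y) Q (r, m) = Q 1 (r(x := r y), m)"
    "wp (Add x y z) Q (r, m) = Q 1 (r(x := r y + r z), m)"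
    "wp (Sub x y z) Q (r, m) = Q 1 (r(x := r y - r z), m)"
    "wp (Half x y) Q (r, m) = Q 1 (r(x := r y div 2), m)"
    "wp (Load x a y) Q (r, m) = Q 1 (r(x := m a (r y)), m)"
    "wp (Store a x y) Q (r, m) = Q 1 (r, m(a := (m a)(r x := r y)))"
    unfolding wp_def iff by blast+
qed

lemma wp_Seq [simp]: "wp (p ;; q) Q s = wp p (\<lambda>t. wp q (\<lambda>u. Q (t + u))) s"
proof -
  have "exec (p ;; q) s v s'' \<longleftrightarrow> (\<exists>t s' u. v = t + u \<and> exec p s t s' \<and> exec q s' u s'')" for v s''
    using exec.Seq[of p s _ _ q _ s''] by (auto elim!: exec_SeqE)
  then show ?thesis unfolding wp_def by (metis (no_types, lifting))
qed

lemma wp_If [simp]: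
  "wp (If_Nonzero x p q) Q (r, m) =
    (if r x \<noteq> 0 then wp p (\<lambda>t. Q (t + 1)) (r, m) else wp q (\<lambda>t. Q (t + 1)) (r, m))"
proof -
  have "exec (If_Nonzero x p q) (r, m) t s' \<longleftrightarrow>
    (\<exists>u. t = u + 1 \<and> exec (if r x \<noteq> 0 then p else q) (r, m) u s')" for t s'
    using exec.If_True[of "(r, m)" x p _ s' q] exec.If_False[of "(r, m)" x q _ s' p]
    by (auto elim!: exec_IfE)
  then show ?thesis unfolding wp_def by auto
qed

lemma wp_mono: "wp p Q s \<Longrightarrow> (\<And>t s'. Q t s' \<Longrightarrow> Q' t s') \<Longrightarrow> wp p Q' s"
  unfolding wp_def by blast

section \<open>Frame conditions and loop rules\<close>

fun written_regs :: "com \<Rightarrow> nat set" where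
  "written_regs Skip = {}"
| "written_regs (Const x n) = {x}"
| "written_regs (Copy x y) = {x}"
| "written_regs (Add x y z) = {x}"
| "written_regs (Sub x y z) = {x}"
| "written_regs (Half x y) = {x}"
| "written_regs (Load x a y) = {x}"
| "written_regs (Store a x y) = {}"
| "written_regs (p ;; q) = written_regs p \<union> written_regs q"
| "written_regs (If_Nonzero x p q) = written_regs p \<union> written_regs q"
| "written_regs (While_Nonzero x p) = written_regs p"

fun written_arrays :: "com \<Rightarrow> nat set" where
  "written_arrays (Store a x y) = {a}"
| "written_arrays (p ;; q) = written_arrays p \<union> written_arrays q"
| "written_arrays (If_Nonzero x p q) = written_arrays p \<union> written_arrays q"
| "written_arrays (While_Nonzero x p) = written_arrays p"
| "written_arrays _ = {}"

text \<open>A syntactic frame condition: loop invariants may stay silent about everything that the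
  body never writes.\<close>

definition agree :: "com \<Rightarrow> state \<Rightarrow> state \<Rightarrow> bool" where
  "agree p s s' \<longleftrightarrow> (\<forall>x. x \<notin> written_regs p \<longrightarrow> fst s' x = fst s x) \<and>
    (\<forall>a. a \<notin> written_arrays p \<longrightarrow> snd s' a = snd s a)"

lemma exec_agree: "exec p s t s' \<Longrightarrow> agree p s s'"
  by (induction rule: exec.induct) (auto simp: agree_def)

lemma wp_frame: "wp p Q s \<Longrightarrow> wp p (\<lambda>t s'. Q t s' \<and> agree p s s') s"
  unfolding wp_def by (metis exec_agree)

text \<open>The number \<open>N\<close> of rounds is known in advance, so induction on the remaining
  rounds gives termination together with the bound: each round costs its body and one test, and one
  more test fails at the end.\<close>

lemma wp_While:
  assumes "I 0 s0"
    and "\<And>k s. k < N \<Longrightarrow> I k s \<Longrightarrow> agree body s0 s \<Longrightarrow>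
      fst s x \<noteq> 0 \<and> wp body (\<lambda>t s'. t \<le> T \<and> I (Suc k) s') s"
    and "\<And>s. I N s \<Longrightarrow> agree body s0 s \<Longrightarrow> fst s x = 0"
    and post: "\<And>t s. t \<le> N * (T + 1) + 1 \<Longrightarrow> I N s \<Longrightarrow> agree body s0 s \<Longrightarrow> Q t s"
  shows "wp (While_Nonzero x body) Q s0"
proof -
  have "\<exists>t s'. exec (While_Nonzero x body) s t s' \<and> t \<le> (N - k) * (T + 1) + 1 \<and> I N s' \<and> agree body s0 s'"
    if "k \<le> N" "I k s" "agree body s0 s" for k s
    using that
  proof (induction "N - k" arbitrary: k s)
    case 0
    then have "I N s" "fst s x = 0" using assms(3) by auto
    from exec.While_False[OF this(2), of body] this(1) 0(4) show ?case by (intro exI conjI) auto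
  next
    case (Suc d)
    then have "k < N" by simp
    from assms(2)[OF this Suc.prems(2,3)] obtain t s' where
      s': "fst s x \<noteq> 0" "exec body s t s'" "t \<le> T" "I (Suc k) s'"
      unfolding wp_def by blast
    have ag: "agree body s0 s'"
      using exec_agree[OF s'(2)] Suc.prems(3) unfolding agree_def by simp
    have "\<exists>u s''. exec (While_Nonzero x body) s' u s'' \<and> u \<le> (N - Suc k) * (T + 1) + 1 \<and> I N s'' \<and> agree body s0 s''"
      by (rule Suc.hyps(1)) (use Suc.hyps(2) s'(4) \<open>k < N\<close> ag in auto)
    then obtain u s'' where s'': "exec (While_Nonzero x body) s' u s''"
      "u \<le> (N - Suc k) * (T + 1) + 1" "I N s''" "agree body s0 s''"
      by blast
    have "exec (While_Nonzero x body) s (t + u + 1) s''"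
      by (rule exec.While_True[OF s'(1,2) s''(1)])
    moreover have "N - k = Suc (N - Suc k)" using \<open>k < N\<close> by simp
    then have "t + u + 1 \<le> (N - k) * (T + 1) + 1" using s'(3) s''(2) by simp
    ultimately show ?case using s'' by blast
  qed
  from this[of 0 s0] assms(1) obtain t s' where "exec (While_Nonzero x body) s0 t s'"
    "t \<le> N * (T + 1) + 1" "I N s'" "agree body s0 s'"
    by (auto simp: agree_def)
  with post[of t s'] show ?thesis unfolding wp_def by (intro exI[of _ t] exI[of _ s'] conjI) auto
qed

text \<open>Register 1 may be overwritten by the body, so nested loops share it.\<close>

definition For :: "nat \<Rightarrow> nat \<Rightarrow> com \<Rightarrow> com" where
  "For i n body = Const i 0 ;; Sub 1 n i ;;
    While_Nonzero 1 (body ;; Const 1 1 ;; Add i i 1 ;; Sub 1 n i)"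

lemma written_For [simp]:
  "written_regs (For i n body) = insert i (insert 1 (written_regs body))"
  "written_arrays (For i n body) = written_arrays body"
  by (auto simp: For_def)

text \<open>By \<open>stable\<close> the invariant ignores the counter and the scratch register 1,
  so the bookkeeping cannot destroy it. In \<open>T + 4\<close> the body is followed by three
  bookkeeping instructions and accompanied by the loop test; the final 3 is for two initial
  instructions and the failing test.\<close>

lemma wp_For:
  assumes init: "I 0 r0 m0" and N: "r0 n = N"
    and step: "\<And>k r m. k < N \<Longrightarrow> I k r m \<Longrightarrow> r i = k \<Longrightarrow>
      (\<And>x. x \<notin> insert i (insert 1 (written_regs body)) \<Longrightarrow> r x = r0 x) \<Longrightarrow>
      (\<And>a. a \<notin> written_arrays body \<Longrightarrow> m a = m0 a) \<Longrightarrow>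
      wp body (\<lambda>t s'. t \<le> T \<and> I (Suc k) (fst s') (snd s')) (r, m)"
    and stable: "\<And>k r m u v. I k (r(1 := u, i := v)) m = I k r m"
    and disj: "i \<noteq> 1 \<and> n \<noteq> 1 \<and> i \<noteq> n \<and> i \<notin> written_regs body \<and> n \<notin> written_regs body"
    and post: "\<And>t r m. t \<le> N * (T + 4) + 3 \<Longrightarrow> I N r m \<Longrightarrow>
      (\<And>x. x \<notin> insert i (insert 1 (written_regs body)) \<Longrightarrow> r x = r0 x) \<Longrightarrow>
      (\<And>a. a \<notin> written_arrays body \<Longrightarrow> m a = m0 a) \<Longrightarrow> Q t (r, m)"
  shows "wp (For i n body) Q (r0, m0)"
proof -
  from disj have regs: "i \<noteq> 1" "n \<noteq> 1" "i \<noteq> n" "i \<notin> written_regs body" "n \<notin> written_regs body"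
    by auto
  define J where "J k s \<longleftrightarrow> I k (fst s) (snd s) \<and> fst s i = k \<and> fst s 1 = N - k" for k s
  let ?s1 = "(r0(i := 0, 1 := N), m0)"
  let ?body = "body ;; Const 1 1 ;; Add i i 1 ;; Sub 1 n i"
  have st1: "I k (r(i := v, 1 := u)) m = I k r m" "I k (r(1 := u)) m = I k r m"
      "I k (r(i := v)) m = I k r m" for k r m u v
  proof -
    show "I k (r(1 := u)) m = I k r m"
      using stable[of k r u "r i" m] fun_upd_triv[of "r(1 := u)" i] regs(1) by auto
    show "I k (r(i := v)) m = I k r m" using stable[of k r "r 1" v m] by (metis fun_upd_triv)
    show "I k (r(i := v, 1 := u)) m = I k r m"
      using stable[of k r u v m] fun_upd_twist[OF regs(1), of r v u] by metis
  qed
  have n: "r n = N" if "agree ?body ?s1 (r, m)" for r m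
    using that regs N unfolding agree_def by auto
  have "wp (While_Nonzero 1 ?body) (\<lambda>t. Q (2 + t)) ?s1"
  proof (rule wp_While[where I = J and N = N and T = "T + 3"], goal_cases)
    case 1
    show ?case using init regs st1(1) by (simp add: J_def)
  next
    case (2 k s)
    obtain r m where s: "s = (r, m)" by (cases s)
    have ik: "I k r m" "r i = k" "r 1 = N - k" using 2 by (auto simp: J_def s)
    have fr: "\<And>x. x \<notin> insert i (insert 1 (written_regs body)) \<Longrightarrow> r x = r0 x"
      "\<And>a. a \<notin> written_arrays body \<Longrightarrow> m a = m0 a"
      using 2(3) by (auto simp: agree_def s)
    have rn: "r n = N" using n 2(3) s by simp
    have "wp body (\<lambda>t s'. t \<le> T \<and> I (Suc k) (fst s') (snd s')) (r, m)"
      by (rule step) (use 2 ik fr in auto)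
    then have "wp body (\<lambda>t s'. (t \<le> T \<and> I (Suc k) (fst s') (snd s')) \<and> agree body (r, m) s') (r, m)"
      by (rule wp_frame)
    then have "wp ?body (\<lambda>t s'. t \<le> T + 3 \<and> J (Suc k) s') (r, m)"
      unfolding wp_Seq
    proof (rule wp_mono, goal_cases)
      case (1 t s')
      obtain r' m' where s': "s' = (r', m')" by (cases s')
      have "r' i = k" "r' n = N" using 1 ik rn regs unfolding agree_def s' by auto
      then show ?case using 1 regs st1 unfolding s' J_def by simp
    qed
    then show ?case using ik 2(1) s by simp
  next
    case (3 s)
    then show ?case by (simp add: J_def)
  next
    case (4 t s)
    obtain r m where s: "s = (r, m)" by (cases s)
    show ?case unfolding s
    proof (rule post)
      show "I N r m" using 4 by (simp add: J_def s)
      show "2 + t \<le> N * (T + 4) + 3" using 4(1) by (simp add: algebra_simps)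
    qed (use 4(3) in \<open>auto simp: agree_def s\<close>)
  qed
  moreover have "(r0(i := 0))(1 := r0 n - (r0(i := 0)) i) = r0(i := 0, 1 := N)" using N by simp
  ultimately show ?thesis unfolding For_def using regs by (simp add: N)
qed

section \<open>Linear codes over a finite field\<close>

definition dot :: "nat \<Rightarrow> (nat \<Rightarrow> 'f::field) \<Rightarrow> (nat \<Rightarrow> 'f) \<Rightarrow> 'f" where
  "dot n x y = (\<Sum>j<n. x j * y j)"

text \<open>Vectors of length \<open>n\<close> are total functions that vanish from \<open>n\<close>
  on, the elements of \<open>words {..<n}\<close>; equality of vectors is then plain equality of
  functions.\<close>

definition words :: "nat set \<Rightarrow> (nat \<Rightarrow> 'f::zero) set" where
  "words S = {x. \<forall>j. j \<notin> S \<longrightarrow> x j = 0}"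

text \<open>Subspaces. Over a finite field the cardinality takes the role of the dimension:
  dimension \<open>s\<close> means that there are as many words as the field size to the power
  \<open>s\<close>.\<close>

definition linear_code :: "(nat \<Rightarrow> 'f::field) set \<Rightarrow> bool" where
  "linear_code W \<longleftrightarrow> (\<lambda>_. 0) \<in> W \<and> (\<forall>x\<in>W. \<forall>y\<in>W. \<forall>c. (\<lambda>j. x j + c * y j) \<in> W)"

definition adjoin :: "(nat \<Rightarrow> 'f::field) set \<Rightarrow> (nat \<Rightarrow> 'f) \<Rightarrow> (nat \<Rightarrow> 'f) set" where
  "adjoin W g = (\<lambda>(w, c) j. w j + c * g j) ` (W \<times> UNIV)"

definition span_of :: "(nat \<Rightarrow> nat \<Rightarrow> 'f::field) \<Rightarrow> nat set \<Rightarrow> (nat \<Rightarrow> 'f) set" where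
  "span_of g L = range (\<lambda>c j. \<Sum>l\<in>L. c l * g l j)"

definition annihilator :: "nat \<Rightarrow> (nat \<Rightarrow> nat \<Rightarrow> 'f::field) \<Rightarrow> nat \<Rightarrow> (nat \<Rightarrow> 'f) set" where
  "annihilator n a m = {x \<in> words {..<n}. \<forall>i<m. dot n (a i) x = 0}"

definition vanishing :: "(nat \<Rightarrow> 'f::field) set \<Rightarrow> nat set \<Rightarrow> (nat \<Rightarrow> 'f) set" where
  "vanishing W S = {w \<in> W. \<forall>j\<in>S. w j = 0}"

text \<open>Linear independence, on \<open>W\<close>, of the coordinate functionals at the positions
  in \<open>S\<close>, in counting form: each position divides the number of remaining words by the
  field size.\<close>

definition independent_on :: "(nat \<Rightarrow> 'f::{field,finite}) set \<Rightarrow> nat set \<Rightarrow> bool" where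
  "independent_on W S \<longleftrightarrow> card (vanishing W S) * card (UNIV :: 'f set) ^ card S = card W"

definition info_sets :: "nat \<Rightarrow> (nat \<Rightarrow> 'f::{field,finite}) set \<Rightarrow> nat set set" where
  "info_sets n W = {S. S \<subseteq> {..<n} \<and> card (UNIV :: 'f set) ^ card S = card W \<and>
    vanishing W S = {\<lambda>_. 0}}"

lemma card_field_ge_2: "card (UNIV :: 'f::{field,finite} set) \<ge> 2"
proof -
  have "card {0, 1 :: 'f} \<le> card (UNIV :: 'f set)" by (intro card_mono) auto
  then show ?thesis by simp
qed

lemma dot_linear: "dot n a (\<lambda>j. x j + c * y j) = dot n a x + c * dot n a y"
  by (simp add: dot_def algebra_simps sum.distrib sum_distrib_left)

lemma dot_commute: "dot n x y = dot n y x"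
  by (simp add: dot_def mult.commute)

lemma dot_zero [simp]: "dot n a (\<lambda>_. 0) = 0" "dot n (\<lambda>_. 0) a = 0"
  by (simp_all add: dot_def)

lemma linear_codeI:
  assumes "(\<lambda>_. 0) \<in> W" "\<And>x y c. x \<in> W \<Longrightarrow> y \<in> W \<Longrightarrow> (\<lambda>j. x j + c * y j) \<in> W"
  shows "linear_code W"
  using assms by (simp add: linear_code_def)

lemma linear_code_zero: "linear_code W \<Longrightarrow> (\<lambda>_. 0) \<in> W"
  and linear_code_axpy: "linear_code W \<Longrightarrow> x \<in> W \<Longrightarrow> y \<in> W \<Longrightarrow> (\<lambda>j. x j + c * y j) \<in> W"
  by (simp_all add: linear_code_def)

lemma linear_code_scale: "linear_code W \<Longrightarrow> x \<in> W \<Longrightarrow> (\<lambda>j. c * x j) \<in> W"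
  using linear_code_axpy[of W "\<lambda>_. 0" x c] linear_code_zero[of W] by simp

lemma linear_code_words: "linear_code (words S)"
  by (rule linear_codeI) (auto simp: words_def)

lemma linear_code_vanishing: "linear_code W \<Longrightarrow> linear_code (vanishing W S)"
  by (rule linear_codeI) (auto simp: vanishing_def linear_code_zero linear_code_axpy)

lemma linear_code_annihilator: "linear_code (annihilator n a m)"
  by (rule linear_codeI)
    (auto simp: annihilator_def linear_code_zero[OF linear_code_words] linear_code_axpy[OF linear_code_words] dot_linear)

lemma annihilator_subset: "annihilator n a m \<subseteq> words {..<n}"
  by (auto simp: annihilator_def)

lemma adjoin_iff: "x \<in> adjoin W g \<longleftrightarrow> (\<exists>w\<in>W. \<exists>c. x = (\<lambda>j. w j + c * g j))"
  by (auto simp: adjoin_def)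

section \<open>Adjoining a word and kernels of functionals\<close>

lemma linear_code_adjoin:
  assumes "linear_code W" shows "linear_code (adjoin W g)"
proof (rule linear_codeI)
  show "(\<lambda>_. 0) \<in> adjoin W g"
    unfolding adjoin_iff using linear_code_zero[OF assms] by (intro bexI[of _ "\<lambda>_. 0"] exI[of _ 0]) auto
next
  fix x y c assume "x \<in> adjoin W g" "y \<in> adjoin W g"
  then obtain u a v b where uv: "u \<in> W" "v \<in> W" "x = (\<lambda>j. u j + a * g j)" "y = (\<lambda>j. v j + b * g j)"
    unfolding adjoin_iff by blast
  then show "(\<lambda>j. x j + c * y j) \<in> adjoin W g" unfolding adjoin_iff
    by (intro bexI[of _ "\<lambda>j. u j + c * v j"] exI[of _ "a + c * b"])
      (auto simp: algebra_simps linear_code_axpy[OF assms])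
qed

text \<open>The representation \<open>w + c * g\<close> is unique: two of them with different
  \<open>c\<close> could be solved for \<open>g\<close>, which would put \<open>g\<close> into
  \<open>W\<close>.\<close>

lemma card_adjoin:
  fixes W :: "(nat \<Rightarrow> 'f::{field,finite}) set"
  assumes W: "linear_code W" and g: "g \<notin> W"
  shows "card (adjoin W g) = card (UNIV :: 'f set) * card W"
proof -
  have "inj_on (\<lambda>(w, c) j. w j + c * g j) (W \<times> (UNIV :: 'f set))"
  proof (rule inj_onI, clarify)
    fix u a v b assume uv: "u \<in> W" "v \<in> W"
      and eq: "(\<lambda>j. u j + a * g j) = (\<lambda>j. v j + b * g j)"
    have *: "u j + a * g j = v j + b * g j" for j using fun_cong[OF eq] .
    have "a = b"
    proof (rule ccontr)
      assume "a \<noteq> b"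
      have "(\<lambda>j. inverse (a - b) * (v j + (- 1) * u j)) \<in> W"
        by (rule linear_code_scale[OF W], rule linear_code_axpy[OF W uv(2,1)])
      moreover have "inverse (a - b) * (v j + (- 1) * u j) = g j" for j
      proof -
        have "v j + (- 1) * u j = (a - b) * g j" using *[of j] by (simp add: algebra_simps)
        then show ?thesis using \<open>a \<noteq> b\<close> by simp
      qed
      ultimately show False using g by simp
    qed
    then show "u = v \<and> a = b" using * by auto
  qed
  then have "card (adjoin W g) = card (W \<times> (UNIV :: 'f set))"
    unfolding adjoin_def by (rule card_image)
  then show ?thesis by (simp add: card_cartesian_product)
qed

text \<open>Subtracting \<open>(\<phi> x / \<phi> g) * g\<close> from \<open>x\<close> lands in the
  kernel of the functional, which therefore has codimension one.\<close>

lemma functional_adjoin: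
  assumes W: "linear_code W" and g: "g \<in> W" "\<phi> g \<noteq> (0 :: 'f::field)"
    and lin: "\<And>x y c. \<phi> (\<lambda>j. x j + c * y j) = \<phi> x + c * \<phi> y"
  shows "W = adjoin {x \<in> W. \<phi> x = 0} g"
proof (rule Set.set_eqI)
  fix x
  show "x \<in> W \<longleftrightarrow> x \<in> adjoin {x \<in> W. \<phi> x = 0} g"
  proof
    assume x: "x \<in> W"
    let ?c = "\<phi> x / \<phi> g"
    have "(\<lambda>j. x j + (- ?c) * g j) \<in> {x \<in> W. \<phi> x = 0}"
      using linear_code_axpy[OF W x g(1), of "- ?c"] lin[of x "- ?c" g] g(2) by simp
    then show "x \<in> adjoin {x \<in> W. \<phi> x = 0} g"
      unfolding adjoin_iff by (intro bexI[of _ "\<lambda>j. x j + (- ?c) * g j"] exI[of _ ?c]) auto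
  qed (auto simp: adjoin_iff intro!: linear_code_axpy[OF W] g)
qed

text \<open>Rank-nullity for a single nonzero functional. It is applied to coordinates when
  positions are chosen and to products with a row during elimination.\<close>

lemma card_functional:
  fixes W :: "(nat \<Rightarrow> 'f::{field,finite}) set"
  assumes W: "linear_code W" and g: "g \<in> W" "\<phi> g \<noteq> (0 :: 'f)"
    and lin: "\<And>x y c. \<phi> (\<lambda>j. x j + c * y j) = \<phi> x + c * \<phi> y"
  shows "card W = card (UNIV :: 'f set) * card {x \<in> W. \<phi> x = 0}"
proof -
  \<comment> \<open>With zero words and \<open>c = - 1\<close>, linearity reads
    \<open>\<phi> 0 = \<phi> 0 - \<phi> 0\<close>.\<close>
  have "\<phi> (\<lambda>_. 0) = 0" using lin[of "\<lambda>_. 0" "- 1" "\<lambda>_. 0"] by simp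
  then have "linear_code {x \<in> W. \<phi> x = 0}"
    using W by (intro linear_codeI) (auto simp: linear_code_zero linear_code_axpy lin)
  then have "card (adjoin {x \<in> W. \<phi> x = 0} g) = card (UNIV :: 'f set) * card {x \<in> W. \<phi> x = 0}"
    by (rule card_adjoin) (use g in simp)
  then show ?thesis using functional_adjoin[OF W g lin] by simp
qed

section \<open>Spans and the size of the full code\<close>

lemma span_ofI: "x = (\<lambda>j. \<Sum>l\<in>L. c l * g l j) \<Longrightarrow> x \<in> span_of g L"
  by (auto simp: span_of_def)

lemma span_of_empty [simp]: "span_of g {} = {\<lambda>_. 0}"
  by (auto simp: span_of_def)

lemma span_of_insert:
  assumes "finite L" "l \<notin> L"
  shows "span_of g (insert l L) = adjoin (span_of g L) (g l)"
proof (rule Set.set_eqI, rule iffI)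
  fix x assume "x \<in> span_of g (insert l L)"
  then obtain c where "x = (\<lambda>j. \<Sum>i\<in>insert l L. c i * g i j)" by (auto simp: span_of_def)
  then have "x = (\<lambda>j. (\<Sum>i\<in>L. c i * g i j) + c l * g l j)"
    using assms by (simp add: add.commute)
  moreover have "(\<lambda>j. \<Sum>i\<in>L. c i * g i j) \<in> span_of g L" by (auto simp: span_of_def)
  ultimately show "x \<in> adjoin (span_of g L) (g l)" 
    unfolding adjoin_iff by (intro bexI[of _ "\<lambda>j. \<Sum>i\<in>L. c i * g i j"] exI[of _ "c l"])
next
  fix x assume "x \<in> adjoin (span_of g L) (g l)"
  then obtain c a where x: "x = (\<lambda>j. (\<Sum>i\<in>L. c i * g i j) + a * g l j)"
    by (auto simp: adjoin_iff span_of_def)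
  have "(\<Sum>i\<in>insert l L. (c(l := a)) i * g i j) = x j" for j
  proof -
    have "(\<Sum>i\<in>L. (c(l := a)) i * g i j) = (\<Sum>i\<in>L. c i * g i j)"
      using assms(2) by (intro sum.cong) auto
    then show ?thesis using assms by (simp add: x)
  qed
  then have "x = (\<lambda>j. \<Sum>i\<in>insert l L. (c(l := a)) i * g i j)" by simp
  then show "x \<in> span_of g (insert l L)" by (rule span_ofI)
qed

lemma linear_code_span_of: "finite L \<Longrightarrow> linear_code (span_of g L)"
proof (induction L rule: finite_induct)
  case empty
  show ?case by (rule linear_codeI) auto
qed (simp add: span_of_insert linear_code_adjoin)

lemma span_of_least:
  assumes "linear_code W" "finite L" "\<And>l. l \<in> L \<Longrightarrow> g l \<in> W"
  shows "span_of g L \<subseteq> W"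
  using assms(2,3)
proof (induction L rule: finite_induct)
  case (insert l L)
  then show ?case by (auto simp: span_of_insert adjoin_iff intro!: linear_code_axpy[OF assms(1)])
qed (simp add: linear_code_zero[OF assms(1)])

lemma span_of_superset:
  assumes "finite L" "l \<in> L"
  shows "g l \<in> span_of g L"
proof -
  have "g l j = (\<Sum>i\<in>L. (if i = l then 1 else 0) * g i j)" for j
    using assms by (simp add: if_distrib[of "\<lambda>x. x * _"] cong: if_cong)
  then have "g l = (\<lambda>j. \<Sum>i\<in>L. (if i = l then 1 else 0) * g i j)" by blast
  then show ?thesis by (rule span_ofI)
qed

lemma adjoin_base: "W \<subseteq> adjoin W g"
proof
  fix w assume "w \<in> W"
  then show "w \<in> adjoin W g" unfolding adjoin_iff by (intro bexI[of _ w] exI[of _ 0]) auto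
qed

lemma adjoin_vector: "linear_code W \<Longrightarrow> g \<in> adjoin W g"
  unfolding adjoin_iff by (intro bexI[of _ "\<lambda>_. 0"] exI[of _ 1]) (auto simp: linear_code_zero)

lemma span_of_units:
  assumes "finite S"
  shows "span_of (\<lambda>l j. if j = l then 1 else 0 :: 'f::field) S = words S"
proof
  show "span_of (\<lambda>l j. if j = l then 1 else 0 :: 'f) S \<subseteq> words S"
    by (rule span_of_least[OF linear_code_words assms]) (auto simp: words_def)
  show "words S \<subseteq> span_of (\<lambda>l j. if j = l then 1 else 0 :: 'f) S"
  proof
    fix x :: "nat \<Rightarrow> 'f" assume x: "x \<in> words S"
    have "x j = (\<Sum>l\<in>S. x l * (if j = l then 1 else 0))" for j
      using x assms by (auto simp: words_def if_distrib[of "\<lambda>y. _ * y"] cong: if_cong)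
    then have "x = (\<lambda>j. \<Sum>l\<in>S. x l * (if j = l then 1 else 0))" by blast
    then show "x \<in> span_of (\<lambda>l j. if j = l then 1 else 0) S"
      by (rule span_ofI)
  qed
qed

lemma card_words:
  assumes "finite S"
  shows "card (words S :: (nat \<Rightarrow> 'f::{field,finite}) set) = card (UNIV :: 'f set) ^ card S"
  using assms
proof (induction S rule: finite_induct)
  case empty
  have "(words {} :: (nat \<Rightarrow> 'f) set) = {\<lambda>_. 0}" by (auto simp: words_def)
  then show ?case by simp
next
  case (insert l S)
  let ?e = "\<lambda>l j. if j = l then 1 else 0 :: 'f"
  have "words (insert l S) = adjoin (words S) (?e l)"
    using insert.hyps span_of_insert[of S l ?e] span_of_units[of S, where 'f = 'f]
      span_of_units[of "insert l S", where 'f = 'f] by simp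
  moreover have "?e l \<notin> words S" using insert by (auto simp: words_def)
  ultimately show ?case using insert by (simp add: card_adjoin linear_code_words)
qed

text \<open>The cardinality is a power of a positive number, whereas \<open>card\<close> of an
  infinite set is 0.\<close>

lemma finite_words: "finite (words {..<n} :: (nat \<Rightarrow> 'f::{field,finite}) set)"
  using card_words[of "{..<n}", where 'f = 'f] card_field_ge_2[where 'f = 'f]
  by (intro card_ge_0_finite) simp

section \<open>Vanishing subcodes and independent positions\<close>

lemma vanishing_empty [simp]: "vanishing W {} = W"
  by (simp add: vanishing_def)

lemma vanishing_insert: "vanishing W (insert j S) = {w \<in> vanishing W S. w j = 0}"
  by (auto simp: vanishing_def)

lemma card_vanishing_insert:
  fixes W :: "(nat \<Rightarrow> 'f::{field,finite}) set"
  assumes "linear_code W" "vanishing W (insert j S) \<noteq> vanishing W S"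
  shows "card (vanishing W S) = card (UNIV :: 'f set) * card (vanishing W (insert j S))"
proof -
  obtain g where "g \<in> vanishing W S" "g j \<noteq> 0"
    using assms(2) unfolding vanishing_insert by blast
  then show ?thesis unfolding vanishing_insert
    using card_functional[OF linear_code_vanishing[OF assms(1)], of g S "\<lambda>w. w j"] by simp
qed

text \<open>One more position either leaves the vanishing words alone or divides their number by the
  field size, so a set \<open>S\<close> cannot cost more than \<open>card S\<close> such
  factors.\<close>

lemma card_vanishing_ge:
  fixes W :: "(nat \<Rightarrow> 'f::{field,finite}) set"
  assumes "linear_code W" "finite S"
  shows "card W \<le> card (vanishing W S) * card (UNIV :: 'f set) ^ card S"
  using assms(2)
proof (induction S rule: finite_induct)
  case (insert j S)
  show ?case
  proof (cases "vanishing W (insert j S) = vanishing W S")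
    case True
    have "card (vanishing W S) * card (UNIV :: 'f set) ^ card S \<le>
        card (vanishing W S) * (card (UNIV :: 'f set) * card (UNIV :: 'f set) ^ card S)"
      using card_field_ge_2[where 'f = 'f] by (intro mult_le_mono2) simp
    with insert.IH have "card W \<le> \<dots>" by (rule order_trans)
    then show ?thesis using insert.hyps by (simp add: True)
  next
    case False
    show ?thesis using insert.IH insert.hyps
      unfolding card_vanishing_insert[OF assms(1) False] by (simp add: mult_ac)
  qed
qed simp

lemma independent_on_empty: "independent_on W {}"
  by (simp add: independent_on_def)

text \<open>This makes the counting definition greedy. If \<open>j\<close> does not shrink the
  vanishing set, the product in the definition gains a factor without compensation; it was already
  at least \<open>card W\<close>, so it overshoots. If \<open>j\<close> does shrink it, the two
  factors cancel.\<close>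

lemma independent_on_insert:
  fixes W :: "(nat \<Rightarrow> 'f::{field,finite}) set"
  assumes W: "linear_code W" "finite W" and S: "finite S" "j \<notin> S"
  shows "independent_on W (insert j S) \<longleftrightarrow>
    independent_on W S \<and> vanishing W (insert j S) \<noteq> vanishing W S"
proof (cases "vanishing W (insert j S) = vanishing W S")
  case True
  have "0 < card W" using W linear_code_zero by (auto simp: card_gt_0_iff)
  then have "0 < card (vanishing W S) * card (UNIV :: 'f set) ^ card S"
    using card_vanishing_ge[OF W(1) S(1)] by linarith
  then have *: "card (vanishing W S) * card (UNIV :: 'f set) ^ card S <
    card (UNIV :: 'f set) * (card (vanishing W S) * card (UNIV :: 'f set) ^ card S)"
    using card_field_ge_2[where 'f = 'f] by simp
  have "card (vanishing W (insert j S)) * card (UNIV :: 'f set) ^ card (insert j S) \<noteq> card W"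
  proof -
    have "card (vanishing W S) * card (UNIV :: 'f set) ^ card (insert j S) =
      card (UNIV :: 'f set) * (card (vanishing W S) * card (UNIV :: 'f set) ^ card S)"
      using S by (simp add: mult.left_commute)
    then show ?thesis using * card_vanishing_ge[OF W(1) S(1)] unfolding True by linarith
  qed
  then show ?thesis using True by (simp add: independent_on_def)
next
  case False
  then show ?thesis
    using S card_vanishing_insert[OF W(1) False] by (simp add: independent_on_def mult_ac)
qed

section \<open>Information sets and duality\<close>

lemma info_sets_eq:
  "info_sets n W = {S. S \<subseteq> {..<n} \<and> independent_on W S \<and> vanishing W S = {\<lambda>_. 0}}"
  by (auto simp: info_sets_def independent_on_def)

text \<open>Up to scaling, \<open>x\<close> is a row of the systematic generator matrix for
  \<open>C\<close>. It exists because dropping \<open>e\<close> from the independent set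
  \<open>C\<close> must enlarge the vanishing set.\<close>

lemma info_set_unit:
  assumes "linear_code W" "finite W" "C \<in> info_sets n W" "e \<in> C"
  obtains x where "x \<in> W" "x e \<noteq> 0" "\<And>j. j \<in> C - {e} \<Longrightarrow> x j = 0"
proof -
  have "finite C" using assms(3) finite_subset by (auto simp: info_sets_def)
  moreover have "independent_on W (insert e (C - {e}))"
    using assms(3,4) by (simp add: info_sets_eq insert_absorb)
  ultimately have "vanishing W (insert e (C - {e})) \<noteq> vanishing W (C - {e})"
    using independent_on_insert[OF assms(1,2), of "C - {e}" e] by simp
  then show ?thesis using that unfolding vanishing_insert by (auto simp: vanishing_def)
qed

text \<open>Pair a word \<open>y\<close> of \<open>W\<close> that vanishes off \<open>C\<close> with
  the word \<open>x\<close> of \<open>V\<close> that on \<open>C\<close> is nonzero only at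
  \<open>e\<close>. A single term \<open>x e * y e\<close> survives, and orthogonality forces
  \<open>y e = 0\<close>. The size of the complement comes from the product of the two
  cardinalities.\<close>

lemma info_sets_dual_subset:
  fixes V W :: "(nat \<Rightarrow> 'f::{field,finite}) set"
  assumes V: "linear_code V" "V \<subseteq> words {..<n}" and W: "linear_code W" "W \<subseteq> words {..<n}"
    and orth: "\<And>x y. x \<in> V \<Longrightarrow> y \<in> W \<Longrightarrow> dot n x y = 0"
    and card: "card V * card W = card (UNIV :: 'f set) ^ n"
    and C: "C \<in> info_sets n V"
  shows "{..<n} - C \<in> info_sets n W"
proof -
  have Cn: "C \<subseteq> {..<n}" and cardC: "card (UNIV :: 'f set) ^ card C = card V"
    using C by (auto simp: info_sets_def)
  have "y = (\<lambda>_. 0)" if y: "y \<in> vanishing W ({..<n} - C)" for y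
  proof
    fix e
    show "y e = 0"
    proof (cases "e \<in> C")
      case True
      obtain x where x: "x \<in> V" "x e \<noteq> 0" "\<And>j. j \<in> C - {e} \<Longrightarrow> x j = 0"
        using info_set_unit[OF V(1) finite_subset[OF V(2) finite_words] C True] by blast
      have "dot n x y = (\<Sum>j<n. if j = e then x e * y e else 0)"
        unfolding dot_def using x(3) y True by (intro sum.cong) (auto simp: vanishing_def)
      also have "\<dots> = x e * y e" using True Cn by auto
      finally show ?thesis using orth[OF x(1), of y] x(2) y by (simp add: vanishing_def)
    next
      case False
      then show ?thesis using y W(2) by (cases "e < n") (auto simp: vanishing_def words_def)
    qed
  qed
  moreover have "(\<lambda>_. 0) \<in> vanishing W ({..<n} - C)"
    using linear_code_zero[OF linear_code_vanishing[OF W(1)]] .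
  moreover have "card (UNIV :: 'f set) ^ card ({..<n} - C) = card W"
  proof -
    have "card C + card ({..<n} - C) = n"
      using Cn card_mono[OF _ Cn] by (simp add: card_Diff_subset finite_subset)
    then have "card V * card (UNIV :: 'f set) ^ card ({..<n} - C) = card V * card W"
      unfolding card unfolding cardC[symmetric] by (simp flip: power_add)
    moreover have "card V \<noteq> 0" using card_field_ge_2[where 'f = 'f] by (simp flip: cardC)
    ultimately show ?thesis by simp
  qed
  ultimately show ?thesis unfolding info_sets_def by blast
qed

lemma card_info_sets_dual:
  fixes V W :: "(nat \<Rightarrow> 'f::{field,finite}) set"
  assumes V: "linear_code V" "V \<subseteq> words {..<n}" and W: "linear_code W" "W \<subseteq> words {..<n}"
    and orth: "\<And>x y. x \<in> V \<Longrightarrow> y \<in> W \<Longrightarrow> dot n x y = 0"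
    and card: "card V * card W = card (UNIV :: 'f set) ^ n"
  shows "card (info_sets n V) = card (info_sets n W)"
proof -
  have orth': "dot n x y = 0" if "x \<in> W" "y \<in> V" for x y
    using orth[OF that(2,1)] by (simp add: dot_commute)
  have card': "card W * card V = card (UNIV :: 'f set) ^ n" using card by (simp add: mult.commute)
  have "bij_betw (\<lambda>C. {..<n} - C) (info_sets n V) (info_sets n W)"
  proof (rule bij_betw_byWitness[where f' = "\<lambda>C. {..<n} - C"])
  show "(\<lambda>C. {..<n} - C) ` info_sets n V \<subseteq> info_sets n W"
    using info_sets_dual_subset[OF V W orth card] by blast
  show "(\<lambda>C. {..<n} - C) ` info_sets n W \<subseteq> info_sets n V"
    using info_sets_dual_subset[OF W V orth' card'] by blast
  qed (auto simp: info_sets_def)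
  then show ?thesis by (rule bij_betw_same_card)
qed

section \<open>Bases of a represented matroid\<close>

text \<open>Zero padding makes each row an element of \<open>words {..<dim_col A}\<close>.\<close>

definition matrix_row :: "'f::zero mat \<Rightarrow> nat \<Rightarrow> nat \<Rightarrow> 'f" where
  "matrix_row A i j = (if i < dim_row A \<and> j < dim_col A then A $$ (i, j) else 0)"

abbreviation kernel_of :: "'f::field mat \<Rightarrow> (nat \<Rightarrow> 'f) set" where
  "kernel_of A \<equiv> annihilator (dim_col A) (matrix_row A) (dim_row A)"

lemma kernel_of_iff:
  "x \<in> kernel_of A \<longleftrightarrow> x \<in> words {..<dim_col A} \<and>
    (\<forall>i<dim_row A. (\<Sum>j<dim_col A. A $$ (i, j) * x j) = 0)"
  by (auto simp: annihilator_def dot_def matrix_row_def)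

text \<open>A kernel word that vanishes off \<open>S\<close> is exactly a coefficient family for a
  dependency of the columns indexed by \<open>S\<close>. The work lies in passing between the
  indexed family and the set of vectors used by \<open>lin_dep\<close>.\<close>

lemma matroid_indep_iff:
  "matroid_indep A S \<longleftrightarrow>
    S \<subseteq> {..<dim_col A} \<and> vanishing (kernel_of A) ({..<dim_col A} - S) = {\<lambda>_. 0}"
proof (cases "S \<subseteq> {..<dim_col A}")
  case True
  define n m where "n = dim_col A" and "m = dim_row A"
  interpret vec_space "TYPE('a)" m .
  have fin: "finite S" and Sn: "S \<subseteq> {..<n}" using True finite_subset by (auto simp: n_def)
  have carr: "col A ` S \<subseteq> carrier_vec m" by (auto simp: m_def)
  have van: "x \<in> vanishing (kernel_of A) ({..<n} - S) \<longleftrightarrow>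
      x \<in> words S \<and> (\<forall>i<m. (\<Sum>j\<in>S. A $$ (i, j) * x j) = 0)" for x
  proof -
    have "(\<Sum>j<n. A $$ (i, j) * x j) = (\<Sum>j\<in>S. A $$ (i, j) * x j)" if "x \<in> words S" for i
      using that Sn by (intro sum.mono_neutral_right) (auto simp: words_def)
    moreover have "x \<in> words S \<longleftrightarrow> x \<in> words {..<n} \<and> (\<forall>j\<in>{..<n} - S. x j = 0)"
      using Sn by (auto simp: words_def)
    ultimately show ?thesis unfolding vanishing_def kernel_of_iff n_def m_def by auto
  qed
  have "inj_on (col A) S \<and> \<not> lin_dep (col A ` S) \<longleftrightarrow>
    (\<forall>x. x \<in> words S \<and> (\<forall>i<m. (\<Sum>j\<in>S. A $$ (i, j) * x j) = 0) \<longrightarrow> x = (\<lambda>_. 0))"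
    (is "?l \<longleftrightarrow> (\<forall>x. ?P x \<longrightarrow> x = (\<lambda>_. 0))")
  proof (intro iffI allI impI)
    fix x assume l: ?l and x: "?P x"
    show "x = (\<lambda>_. 0)"
    proof
      fix j
      show "x j = 0"
      proof (rule ccontr)
        assume xj: "x j \<noteq> 0"
        then have j: "j \<in> S" using x by (auto simp: words_def)
        \<comment> \<open>Injectivity of \<open>col A\<close> on \<open>S\<close> turns coefficients
          of positions into coefficients of vectors.\<close>
        let ?a = "\<lambda>v. x (the_inv_into S (col A) v)"
        have "lincomb ?a (col A ` S) = 0\<^sub>v m"
        proof (rule eq_vecI)
          fix i assume "i < dim_vec (0\<^sub>v m :: 'a vec)"
          then have i: "i < m" by simp
          have "lincomb ?a (col A ` S) $ i = (\<Sum>v\<in>col A ` S. ?a v * v $ i)"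
            by (rule lincomb_index[OF i carr])
          also have "\<dots> = (\<Sum>j\<in>S. x j * col A j $ i)"
            using l by (simp add: sum.reindex the_inv_into_f_f)
          also have "\<dots> = (\<Sum>j\<in>S. A $$ (i, j) * x j)"
            using i Sn by (intro sum.cong) (auto simp: m_def n_def)
          finally show "lincomb ?a (col A ` S) $ i = 0\<^sub>v m $ i" using x i by simp
        qed (use carr fin in \<open>auto intro!: lincomb_dim\<close>)
        moreover have "?a (col A j) \<noteq> 0" using j l xj by (simp add: the_inv_into_f_f)
        ultimately have "lin_dep (col A ` S)"
          unfolding lin_dep_def using fin j by (intro exI[of _ "col A ` S"] exI[of _ ?a] exI[of _ "col A j"]) auto
        then show False using l by blast
      qed
    qed
  next
    assume r: "\<forall>x. ?P x \<longrightarrow> x = (\<lambda>_. 0)"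
    have inj: "inj_on (col A) S"
    proof (rule inj_onI, rule ccontr)
      fix a b assume ab: "a \<in> S" "b \<in> S" "col A a = col A b" "a \<noteq> b"
      \<comment> \<open>Equal columns at \<open>a\<close> and \<open>b\<close> are a dependency with
        coefficients 1 and -1.\<close>
      let ?x = "\<lambda>j. if j = a then 1 else if j = b then - 1 else 0 :: 'a"
      have eq: "A $$ (i, a) = A $$ (i, b)" if "i < m" for i
      proof -
        have "col A a $ i = col A b $ i" using ab(3) by simp
        moreover have "a < dim_col A" "b < dim_col A" using ab(1,2) Sn by (auto simp: n_def)
        ultimately show ?thesis using that by (simp add: m_def)
      qed
      have "(\<Sum>j\<in>S. A $$ (i, j) * ?x j) = 0" if "i < m" for i
      proof -
        have "(\<Sum>j\<in>S. A $$ (i, j) * ?x j) = (\<Sum>j\<in>{a, b}. A $$ (i, j) * ?x j)"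
          using ab fin by (intro sum.mono_neutral_right) auto
        then show ?thesis using ab(4) eq[OF that] by simp
      qed
      then have "?P ?x" using ab by (auto simp: words_def)
      then have "?x = (\<lambda>_. 0)" using r by blast
      from fun_cong[OF this, of a] show False by simp
    qed
    moreover have "\<not> lin_dep (col A ` S)"
    proof
      assume "lin_dep (col A ` S)"
      then obtain X a v where X: "finite X" "X \<subseteq> col A ` S" "lincomb a X = 0\<^sub>v m" "v \<in> X" "a v \<noteq> 0"
        unfolding lin_dep_def by auto
      let ?x = "\<lambda>j. if j \<in> S \<and> col A j \<in> X then a (col A j) else 0"
      have "(\<Sum>j\<in>S. A $$ (i, j) * ?x j) = 0" if i: "i < m" for i
      proof -
        let ?T = "{j \<in> S. col A j \<in> X}"
        have X': "X = col A ` ?T" using X(2) by auto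
        have "(\<Sum>j\<in>S. A $$ (i, j) * ?x j) = (\<Sum>j\<in>?T. a (col A j) * col A j $ i)"
          using fin i Sn by (intro sum.mono_neutral_cong_right) (auto simp: m_def n_def)
        also have "\<dots> = (\<Sum>v\<in>X. a v * v $ i)"
          by (subst X', subst sum.reindex) (auto intro: inj_on_subset[OF inj])
        also have "\<dots> = lincomb a X $ i" using lincomb_index[OF i, of X a] X(2) carr by auto
        finally show ?thesis using X(3) i by simp
      qed
      then have "?P ?x" by (auto simp: words_def)
      then have x0: "?x = (\<lambda>_. 0)" using r by blast
      obtain j where "j \<in> S" "v = col A j" using X by auto
      with fun_cong[OF x0, of j] show False using X(4,5) by simp
    qed
    ultimately show ?l ..
  qed
  also have "\<dots> \<longleftrightarrow> vanishing (kernel_of A) ({..<n} - S) \<subseteq> {\<lambda>_. 0}"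
    by (simp only: subset_iff van singleton_iff)
  also have "\<dots> \<longleftrightarrow> vanishing (kernel_of A) ({..<n} - S) = {\<lambda>_. 0}"
    using linear_code_zero[OF linear_code_vanishing[OF linear_code_annihilator]]
    by (simp only: subset_singleton_iff) blast
  finally show ?thesis
    using True by (simp add: matroid_indep_def ground_set_def m_def n_def)
qed (simp add: matroid_indep_def ground_set_def)

lemma finite_kernel: "finite (annihilator n a m :: (nat \<Rightarrow> 'f::{field,finite}) set)"
  by (rule finite_subset[OF annihilator_subset finite_words])

text \<open>Maximality of \<open>B\<close> makes its complement minimal among the sets on which only
  the zero word vanishes. Minimality gives, for every position there, a word vanishing on all the
  others, so the positions are independent and their number is determined. Conversely, by
  \<open>card_vanishing_ge\<close> no complement of an independent set is smaller than an
  information set, so \<open>B\<close> cannot be enlarged.\<close>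

lemma matroid_bases_eq:
  fixes A :: "'f::{field,finite} mat"
  shows "matroid_bases A =
    {B. B \<subseteq> {..<dim_col A} \<and> {..<dim_col A} - B \<in> info_sets (dim_col A) (kernel_of A)}"
proof -
  define n K q where "n = dim_col A" and "K = kernel_of A" and "q = card (UNIV :: 'f set)"
  have K: "linear_code K" "finite K" by (simp_all add: K_def linear_code_annihilator finite_kernel)
  have q: "q \<ge> 2" unfolding q_def by (rule card_field_ge_2)
  have ind: "matroid_indep A S \<longleftrightarrow> S \<subseteq> {..<n} \<and> vanishing K ({..<n} - S) = {\<lambda>_. 0}" for S
    by (simp add: matroid_indep_iff n_def K_def)
  have le: "card K \<le> q ^ card ({..<n} - S)" if "matroid_indep A S" for S
    using card_vanishing_ge[OF K(1), of "{..<n} - S"] that by (simp add: ind q_def)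
  have "B \<in> matroid_bases A \<longleftrightarrow> B \<subseteq> {..<n} \<and> {..<n} - B \<in> info_sets n K" for B
  proof
    assume B: "B \<in> matroid_bases A"
    then have iB: "matroid_indep A B" and max: "\<And>S. matroid_indep A S \<Longrightarrow> B \<subseteq> S \<Longrightarrow> S = B"
      by (auto simp: matroid_bases_def)
    let ?C = "{..<n} - B"
    have Bn: "B \<subseteq> {..<n}" and vB: "vanishing K ?C = {\<lambda>_. 0}" using iB ind by auto
    have ex: "\<exists>x \<in> vanishing K (?C - {e}). x e \<noteq> 0" if e: "e \<in> ?C" for e
    proof -
      have "\<not> matroid_indep A (insert e B)" using max[of "insert e B"] e by auto
      moreover have "?C - {e} = {..<n} - insert e B" by auto
      ultimately have "vanishing K (?C - {e}) \<noteq> {\<lambda>_. 0}" using ind e Bn by auto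
      moreover have "(\<lambda>_. 0) \<in> vanishing K (?C - {e})"
        by (rule linear_code_zero[OF linear_code_vanishing[OF K(1)]])
      ultimately obtain x where x: "x \<in> vanishing K (?C - {e})" "x \<noteq> (\<lambda>_. 0)" by blast
      have "x \<notin> vanishing K ?C" using x(2) vB by auto
      then show ?thesis using x(1) by (intro bexI[of _ x]) (auto simp: vanishing_def)
    qed
    \<comment> \<open>The word from \<open>ex\<close> for \<open>e\<close> vanishes on every subset
      of \<open>?C\<close> avoiding \<open>e\<close>. Hence each position shrinks the vanishing set,
      in whatever order positions are added.\<close>
    have "independent_on K D" if "D \<subseteq> ?C" for D
      using finite_subset[OF that finite_Diff[OF finite_lessThan]] that
    proof (induction D rule: finite_induct)
      case (insert e D)
      obtain x where x: "x \<in> vanishing K (?C - {e})" "x e \<noteq> 0" using ex insert.prems by blast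
      then have "x \<in> vanishing K D" "x \<notin> vanishing K (insert e D)"
        using insert.prems insert.hyps by (auto simp: vanishing_def)
      then have "vanishing K (insert e D) \<noteq> vanishing K D" by blast
      then show ?case using insert by (simp add: independent_on_insert[OF K])
    qed (simp add: independent_on_empty)
    then show "B \<subseteq> {..<n} \<and> ?C \<in> info_sets n K" using Bn vB by (auto simp: info_sets_eq)
  next
    assume B: "B \<subseteq> {..<n} \<and> {..<n} - B \<in> info_sets n K"
    then have iB: "matroid_indep A B" and cK: "q ^ card ({..<n} - B) = card K"
      by (auto simp: info_sets_def ind q_def)
    have "S = B" if S: "matroid_indep A S" "B \<subseteq> S" for S
    proof -
      have "q ^ card ({..<n} - B) \<le> q ^ card ({..<n} - S)" using le[OF S(1)] cK by simp
      then have "card ({..<n} - B) \<le> card ({..<n} - S)" using q by simp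
      moreover have "{..<n} - S \<subseteq> {..<n} - B" using S by auto
      ultimately have "{..<n} - S = {..<n} - B" by (simp add: card_seteq)
      then show ?thesis using S B ind by auto
    qed
    then show "B \<in> matroid_bases A" using iB by (auto simp: matroid_bases_def)
  qed
  then show ?thesis by (auto simp: n_def K_def)
qed

lemma num_bases_eq:
  fixes A :: "'f::{field,finite} mat"
  shows "num_bases A = card (info_sets (dim_col A) (kernel_of A))"
  unfolding num_bases_def
proof (rule bij_betw_same_card[of "\<lambda>C. {..<dim_col A} - C"],
    rule bij_betw_byWitness[where f' = "\<lambda>C. {..<dim_col A} - C"])
  show "(\<lambda>C. {..<dim_col A} - C) ` info_sets (dim_col A) (kernel_of A) \<subseteq> matroid_bases A"
  proof (clarify)
    fix C assume "C \<in> info_sets (dim_col A) (kernel_of A)"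
    moreover from this have "{..<dim_col A} - ({..<dim_col A} - C) = C" by (auto simp: info_sets_def)
    ultimately show "{..<dim_col A} - C \<in> matroid_bases A" by (simp add: matroid_bases_eq)
  qed
qed (auto simp: matroid_bases_eq info_sets_def)

section \<open>Existence of bases, rank and nullity\<close>

text \<open>Without a basis every number would meet the description in \<open>matroid_rank\<close>,
  and its \<open>THE\<close> would be undetermined.\<close>

lemma matroid_bases_nonempty:
  fixes A :: "'f::{field,finite} mat"
  shows "matroid_bases A \<noteq> {}"
proof -
  have "matroid_indep A {}"
    using linear_code_zero[OF linear_code_annihilator]
    by (auto simp: matroid_indep_iff vanishing_def annihilator_def words_def)
  moreover have "{S. matroid_indep A S} \<subseteq> Pow {..<dim_col A}" by (auto simp: matroid_indep_iff)
  then have fin: "finite {S. matroid_indep A S}" by (rule finite_subset) simp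
  ultimately have "\<exists>B\<in>{S. matroid_indep A S}. \<forall>S\<in>{S. matroid_indep A S}. B \<subseteq> S \<longrightarrow> B = S"
    by (intro finite_has_maximal) auto
  then obtain B where "matroid_indep A B" "\<And>S. matroid_indep A S \<Longrightarrow> B \<subseteq> S \<Longrightarrow> B = S" by auto
  then have "B \<in> matroid_bases A" unfolding matroid_bases_def by fastforce
  then show ?thesis by (rule ex_in_conv[THEN iffD1, OF exI])
qed

text \<open>All information sets of a code have the same size, because the exponent can be read off
  a power of a base that is at least 2. So all bases have the same size too.\<close>

lemma matroid_rank_eq:
  fixes A :: "'f::{field,finite} mat"
  assumes "card (kernel_of A) = card (UNIV :: 'f set) ^ k"
  shows "k \<le> dim_col A" "matroid_rank A = dim_col A - k" "matroid_nullity A = k"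
proof -
  have *: "card B = dim_col A - k \<and> k \<le> dim_col A" if "B \<in> matroid_bases A" for B
  proof -
    have B: "B \<subseteq> {..<dim_col A}"
      and "card (UNIV :: 'f set) ^ card ({..<dim_col A} - B) = card (UNIV :: 'f set) ^ k"
      using that assms by (auto simp: matroid_bases_eq info_sets_def)
    then have "card ({..<dim_col A} - B) = k"
      using card_field_ge_2[where 'f = 'f] power_inject_exp[of "card (UNIV :: 'f set)"] by simp
    then have "dim_col A - card B = k" using B by (simp add: card_Diff_subset finite_subset)
    moreover have "card B \<le> dim_col A" using card_mono[OF _ B] by simp
    ultimately show ?thesis by arith
  qed
  obtain B where B: "B \<in> matroid_bases A" using matroid_bases_nonempty by blast
  show k: "k \<le> dim_col A" using * B by blast
  show r: "matroid_rank A = dim_col A - k"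
    unfolding matroid_rank_def using * B by (intro the_equality) auto
  show "matroid_nullity A = k" unfolding matroid_nullity_def r ground_set_def using k by simp
qed

section \<open>Elimination\<close>

text \<open>After \<open>i\<close> rows, \<open>L\<close> holds the live generators and
  \<open>U\<close> the rows that discarded one. The two powers of the field size express that the
  live generators, and likewise the rows in \<open>U\<close>, are linearly independent. Their sizes
  add up to \<open>n\<close>, as duality will require.\<close>

definition elim_inv ::
    "nat \<Rightarrow> (nat \<Rightarrow> nat \<Rightarrow> 'f::{field,finite}) \<Rightarrow> nat \<Rightarrow> (nat \<Rightarrow> nat \<Rightarrow> 'f) \<Rightarrow> nat set \<Rightarrow> nat set \<Rightarrow> bool"
  where
  "elim_inv n a i g L U \<longleftrightarrow> L \<subseteq> {..<n} \<and> U \<subseteq> {..<i} \<and> card L + card U = n \<and>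
    span_of g L = annihilator n a i \<and> card (annihilator n a i) = card (UNIV :: 'f set) ^ card L \<and>
    card (span_of a U) = card (UNIV :: 'f set) ^ card U"

lemma span_of_cong: "(\<And>l. l \<in> L \<Longrightarrow> g l = h l) \<Longrightarrow> span_of g L = span_of h L"
  by (simp add: span_of_def)

lemma elim_inv_init:
  fixes g :: "nat \<Rightarrow> nat \<Rightarrow> 'f::{field,finite}"
  assumes "\<And>l. l < n \<Longrightarrow> g l = (\<lambda>j. if j = l then 1 else 0)"
  shows "elim_inv n a 0 g {..<n} {}"
proof -
  have "span_of g {..<n} = words {..<n}"
    using span_of_units[of "{..<n}", where 'f = 'f] span_of_cong[of "{..<n}" g] assms by auto
  then show ?thesis by (simp add: elim_inv_def annihilator_def card_words)
qed

lemma annihilator_Suc: "annihilator n a (Suc i) = {x \<in> annihilator n a i. dot n (a i) x = 0}"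
  by (auto simp: annihilator_def less_Suc_eq)

text \<open>A row orthogonal to all generators puts no new condition on their span.\<close>

lemma elim_inv_skip:
  assumes inv: "elim_inv n a i g L U" and 0: "\<And>l. l \<in> L \<Longrightarrow> dot n (a i) (g l) = 0"
  shows "elim_inv n a (Suc i) g L U"
proof -
  have fin: "finite L" using inv finite_subset by (auto simp: elim_inv_def)
  have eq: "span_of g L = annihilator n a i" using inv by (simp add: elim_inv_def)
  have "g l \<in> annihilator n a (Suc i)" if "l \<in> L" for l
    using span_of_superset[OF fin that, of g] 0[OF that] by (simp add: annihilator_Suc eq)
  then have "span_of g L \<subseteq> annihilator n a (Suc i)"
    by (intro span_of_least[OF linear_code_annihilator fin])
  then have "annihilator n a (Suc i) = annihilator n a i"
    unfolding eq by (auto simp: annihilator_Suc)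
  then show ?thesis using inv by (auto simp: elim_inv_def)
qed

lemma elim_inv_pivot:
  fixes g h :: "nat \<Rightarrow> nat \<Rightarrow> 'f::{field,finite}"
  assumes inv: "elim_inv n a i g L U" and p: "p \<in> L" "dot n (a i) (g p) \<noteq> 0"
    and h: "\<And>l. l \<in> L - {p} \<Longrightarrow> s l \<noteq> 0" "\<And>l. l \<in> L - {p} \<Longrightarrow> h l = (\<lambda>j. s l * g l j + t l * g p j)"
      "\<And>l. l \<in> L - {p} \<Longrightarrow> dot n (a i) (h l) = 0"
  shows "elim_inv n a (Suc i) h (L - {p}) (insert i U)"
proof -
  let ?K = "annihilator n a i" and ?K' = "annihilator n a (Suc i)" and ?L = "L - {p}"
  let ?q = "card (UNIV :: 'f set)"
  have fin: "finite L" and Ui: "U \<subseteq> {..<i}" and finU: "finite U"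
    using inv finite_subset by (auto simp: elim_inv_def)
  have gK: "span_of g L = ?K" and cK: "card ?K = ?q ^ card L" using inv by (auto simp: elim_inv_def)
  have g: "g l \<in> ?K" if "l \<in> L" for l
    using span_of_superset[OF fin that, of g] by (simp add: gK)
  have hK: "h l \<in> ?K'" if l: "l \<in> ?L" for l
  proof -
    have "(\<lambda>j. s l * g l j + t l * g p j) \<in> ?K"
      by (intro linear_code_axpy[OF linear_code_annihilator] linear_code_scale[OF linear_code_annihilator] g p)
        (use l in simp)
    then show ?thesis using h(2,3)[OF l] by (simp add: annihilator_Suc)
  qed
  then have sub: "span_of h ?L \<subseteq> ?K'"
    by (intro span_of_least[OF linear_code_annihilator]) (use fin in auto)
  have sp: "linear_code (span_of h ?L)" using fin by (simp add: linear_code_span_of)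
  let ?E = "adjoin (span_of h ?L) (g p)"
  have E: "linear_code ?E" using sp by (rule linear_code_adjoin)
  have "g l \<in> ?E" if l: "l \<in> L" for l
  proof (cases "l = p")
    case True
    then show ?thesis using adjoin_vector[OF sp] by simp
  next
    case False
    with l have l: "l \<in> ?L" by simp
    have "h l \<in> ?E" using span_of_superset[of ?L l h] fin l adjoin_base by blast
    then have "(\<lambda>j. inverse (s l) * (h l j + (- t l) * g p j)) \<in> ?E"
      by (intro linear_code_scale[OF E] linear_code_axpy[OF E] adjoin_vector[OF sp])
    moreover have "inverse (s l) * (h l j + (- t l) * g p j) = g l j" for j
      using h(1,2)[OF l] by simp
    ultimately show ?thesis by simp
  qed
  then have KE: "?K \<subseteq> ?E" using span_of_least[OF E fin, of g] gK by simp
  have "?K' \<subseteq> span_of h ?L"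
  proof
    fix x assume x: "x \<in> ?K'"
    then have "x \<in> ?E" using KE by (auto simp: annihilator_Suc)
    then obtain y c where y: "y \<in> span_of h ?L" "x = (\<lambda>j. y j + c * g p j)"
      by (auto simp: adjoin_iff)
    have "dot n (a i) y = 0" using y(1) sub by (auto simp: annihilator_Suc)
    then have "c * dot n (a i) (g p) = 0"
      using x by (simp add: annihilator_Suc y(2) dot_linear)
    then show "x \<in> span_of h ?L" using p y by simp
  qed
  with sub have span: "span_of h ?L = ?K'" by blast
  have cL: "card L = Suc (card ?L)" using card_Suc_Diff1[OF fin p(1)] by simp
  have "card ?K = ?q * card ?K'"
    unfolding annihilator_Suc by (rule card_functional[OF linear_code_annihilator g[OF p(1)] p(2) dot_linear])
  then have cK': "card ?K' = ?q ^ card ?L"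
    using cK card_field_ge_2[where 'f = 'f] by (simp add: cL)
  have "a i \<notin> span_of a U"
  proof
    assume "a i \<in> span_of a U"
    moreover have "span_of a U \<subseteq> {y. dot n y (g p) = 0}"
    proof (rule span_of_least[OF _ finU])
      show "linear_code {y. dot n y (g p) = 0}"
        by (rule linear_codeI) (auto simp: dot_commute[of n _ "g p"] dot_linear)
      show "a l \<in> {y. dot n y (g p) = 0}" if "l \<in> U" for l
        using g[OF p(1)] Ui that by (auto simp: annihilator_def)
    qed
    ultimately show False using p by auto
  qed
  moreover have "i \<notin> U" using Ui by auto
  ultimately have "card (span_of a (insert i U)) = ?q ^ card (insert i U)"
    using inv finU by (simp add: span_of_insert card_adjoin linear_code_span_of elim_inv_def)
  then show ?thesis
    using inv span cK' cL finU \<open>i \<notin> U\<close> by (auto simp: elim_inv_def)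
qed

text \<open>The rows in \<open>U\<close> are orthogonal to the kernel and the two cardinalities
  multiply to the full power, so duality carries the count from the kernel to the span of these
  rows.\<close>

lemma elim_inv_final:
  fixes A :: "'f::{field,finite} mat"
  assumes inv: "elim_inv (dim_col A) (matrix_row A) (dim_row A) g L U"
  shows "matroid_nullity A = card L" "matroid_rank A = card U"
    "num_bases A = card (info_sets (dim_col A) (span_of g L))"
    "num_bases A = card (info_sets (dim_col A) (span_of (matrix_row A) U))"
proof -
  let ?n = "dim_col A" and ?R = "span_of (matrix_row A) U" and ?q = "card (UNIV :: 'f set)"
  have c: "card (kernel_of A) = ?q ^ card L" "card ?R = ?q ^ card U" "card L + card U = ?n"
    and Um: "U \<subseteq> {..<dim_row A}" and finU: "finite U" and span: "span_of g L = kernel_of A"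
    using inv finite_subset by (auto simp: elim_inv_def)
  show "matroid_nullity A = card L" "matroid_rank A = card U"
    using matroid_rank_eq[OF c(1)] c(3) by auto
  show "num_bases A = card (info_sets ?n (span_of g L))" by (simp add: span num_bases_eq)
  have "card (info_sets ?n (kernel_of A)) = card (info_sets ?n ?R)"
  proof (rule card_info_sets_dual)
    show "?R \<subseteq> words {..<?n}"
      by (rule span_of_least[OF linear_code_words finU]) (auto simp: matrix_row_def words_def)
    show "dot ?n x y = 0" if x: "x \<in> kernel_of A" and y: "y \<in> ?R" for x y
    proof -
      have "?R \<subseteq> {y. dot ?n x y = 0}"
      proof (rule span_of_least[OF _ finU])
        show "linear_code {y. dot ?n x y = 0}" by (rule linear_codeI) (auto simp: dot_linear)
        show "matrix_row A l \<in> {y. dot ?n x y = 0}" if "l \<in> U" for l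
          using x Um that by (auto simp: annihilator_def dot_commute[of _ x])
      qed
      then show ?thesis using y by blast
    qed
    show "card (kernel_of A) * card ?R = ?q ^ ?n" using c by (simp flip: power_add)
  qed (simp_all add: linear_code_annihilator linear_code_span_of finU annihilator_subset)
  then show "num_bases A = card (info_sets ?n ?R)" by (simp add: num_bases_eq)
qed

section \<open>Counting information sets by dynamic programming\<close>

text \<open>A set of word indices below \<open>Q\<close> is coded by the number with these binary digits.\<close>

definition unhit :: "(nat \<Rightarrow> nat \<Rightarrow> 'f::zero) \<Rightarrow> nat \<Rightarrow> nat set \<Rightarrow> nat set" where
  "unhit w Q S = {i. i < Q \<and> (\<forall>j\<in>S. w i j = 0)}"

definition shrink :: "(nat \<Rightarrow> nat \<Rightarrow> 'f::zero) \<Rightarrow> nat \<Rightarrow> nat \<Rightarrow> nat \<Rightarrow> nat" where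
  "shrink w Q j X = set_encode {i \<in> set_decode X. i < Q \<and> w i j = 0}"

definition dp :: "(nat \<Rightarrow> nat \<Rightarrow> 'f::{field,finite}) \<Rightarrow> nat \<Rightarrow> nat \<Rightarrow> nat \<Rightarrow> nat" where
  "dp w Q j X =
    card {S. S \<subseteq> {..<j} \<and> independent_on (w ` {..<Q}) S \<and> unhit w Q S = set_decode X}"

text \<open>
  The table is updated in place. As \<^term>\<open>shrink\<close> decreases masks, treating the masks in ascending
  order reads each entry before it is changed; \<open>dp_partial\<close> is the table after the masks below \<open>X\<close>.
\<close>

definition dp_partial :: "(nat \<Rightarrow> nat \<Rightarrow> 'f::{field,finite}) \<Rightarrow> nat \<Rightarrow> nat \<Rightarrow> nat \<Rightarrow> nat \<Rightarrow> nat" where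
  "dp_partial w Q j X Z = dp w Q j Z + (\<Sum>Y\<in>{Y. Y < X \<and> shrink w Q j Y = Z \<and> Y \<noteq> Z}. dp w Q j Y)"

lemma set_encode_lessThan: "set_encode {..<Q} = 2 ^ Q - 1"
  by (simp add: set_encode_def lessThan_atLeast0 sum_power2)

lemma set_encode_mono: "finite V \<Longrightarrow> U \<subseteq> V \<Longrightarrow> set_encode U \<le> set_encode V"
  unfolding set_encode_def by (rule sum_mono2) auto

lemma shrink_le: "shrink w Q j X \<le> X"
  using set_encode_mono[of "set_decode X" "{i \<in> set_decode X. i < Q \<and> w i j = 0}"]
  by (simp add: shrink_def)

lemma unhit_insert: "unhit w Q (insert j S) = {i \<in> unhit w Q S. w i j = 0}"
  by (auto simp: unhit_def)

lemma vanishing_image: "vanishing (w ` {..<Q}) S = w ` unhit w Q S"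
  by (auto simp: vanishing_def unhit_def)

lemma dp_0: "dp w Q 0 X = (if X = 2 ^ Q - 1 then 1 else 0)"
proof -
  have "unhit w Q {} = set_decode (2 ^ Q - 1)"
    using set_encode_inverse[of "{..<Q}"] by (auto simp: unhit_def set_encode_lessThan)
  then have "{S. S \<subseteq> {..<0} \<and> independent_on (w ` {..<Q}) S \<and> unhit w Q S = set_decode X} =
      (if X = 2 ^ Q - 1 then {{}} else {})"
    by (auto simp: independent_on_empty set_decode_inverse dest: arg_cong[of _ _ set_encode])
  then show ?thesis by (simp add: dp_def)
qed

lemma dp_partial_0: "dp_partial w Q j 0 Z = dp w Q j Z"
  by (simp add: dp_partial_def)

lemma dp_partial_same: "dp_partial w Q j X X = dp w Q j X"
proof -
  have "{Y. Y < X \<and> shrink w Q j Y = X \<and> Y \<noteq> X} = {}"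
    using shrink_le[of w Q j] by (auto simp: not_less[symmetric])
  then show ?thesis unfolding dp_partial_def by (simp only: sum.empty)
qed

lemma dp_partial_Suc:
  "dp_partial w Q j (Suc X) Z =
    dp_partial w Q j X Z + (if shrink w Q j X = Z \<and> X \<noteq> Z then dp w Q j X else 0)"
proof -
  have "{Y. Y < Suc X \<and> shrink w Q j Y = Z \<and> Y \<noteq> Z} =
      (if shrink w Q j X = Z \<and> X \<noteq> Z then insert X else id) {Y. Y < X \<and> shrink w Q j Y = Z \<and> Y \<noteq> Z}"
    by (auto simp: less_Suc_eq)
  then show ?thesis by (simp add: dp_partial_def)
qed

text \<open>Sets containing \<open>j\<close> arise from a set without it whose mask shrinks to
  \<open>Z\<close>. Independence demands a real change of the mask, hence
  \<open>Y \<noteq> Z\<close> in the sum. Injectivity of the listing translates between words and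
  their indices.\<close>

lemma dp_Suc:
  fixes w :: "nat \<Rightarrow> nat \<Rightarrow> 'f::{field,finite}"
  assumes W: "linear_code (w ` {..<Q})" and inj: "inj_on w {..<Q}"
  shows "dp w Q (Suc j) Z = dp_partial w Q j (2 ^ Q) Z"
proof -
  let ?W = "w ` {..<Q}"
  define F where "F X = {S. S \<subseteq> {..<j} \<and> independent_on ?W S \<and> unhit w Q S = set_decode X}" for X
  define I where "I = {Y. Y < 2 ^ Q \<and> shrink w Q j Y = Z \<and> Y \<noteq> Z}"
  have finF: "finite (F X)" for X
    by (rule finite_subset[of _ "Pow {..<j}"]) (auto simp: F_def)
  have fin: "finite S" and notin: "j \<notin> S" if "S \<subseteq> {..<j}" for S
    using that finite_subset by auto
  have ind: "independent_on ?W (insert j S) \<longleftrightarrow>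
      independent_on ?W S \<and> unhit w Q (insert j S) \<noteq> unhit w Q S" if S: "S \<subseteq> {..<j}" for S
  proof -
    have "w ` unhit w Q (insert j S) = w ` unhit w Q S \<longleftrightarrow> unhit w Q (insert j S) = unhit w Q S"
      by (rule inj_on_image_eq_iff[OF inj]) (auto simp: unhit_def)
    then show ?thesis
      using independent_on_insert[OF W _ fin[OF S] notin[OF S]] by (simp add: vanishing_image)
  qed
  \<comment> \<open>Every mask that occurs is below \<open>2 ^ Q\<close>, so a pass over the table
    meets all sources.\<close>
  have enc: "set_encode (unhit w Q S) < 2 ^ Q" "set_decode (set_encode (unhit w Q S)) = unhit w Q S" for S
  proof -
    have "unhit w Q S \<subseteq> {..<Q}" by (auto simp: unhit_def)
    from set_encode_mono[OF finite_lessThan this] show "set_encode (unhit w Q S) < 2 ^ Q"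
      by (simp add: set_encode_lessThan le_diff_conv2 less_eq_Suc_le)
    show "set_decode (set_encode (unhit w Q S)) = unhit w Q S"
      by (rule set_encode_inverse) (simp add: unhit_def)
  qed
  have shr: "shrink w Q j (set_encode (unhit w Q S)) = set_encode (unhit w Q (insert j S))" for S
    unfolding shrink_def enc(2) unhit_insert by (rule arg_cong[of _ _ set_encode]) (auto simp: unhit_def)
  have "{S. S \<subseteq> {..<Suc j} \<and> independent_on ?W S \<and> unhit w Q S = set_decode Z} =
      F Z \<union> insert j ` (\<Union>X\<in>I. F X)" (is "?A = ?B")
  proof (intro subset_antisym subsetI)
    fix S assume S: "S \<in> ?A"
    show "S \<in> ?B"
    proof (cases "j \<in> S")
      case False
      then have "S \<subseteq> {..<j}" using S by (auto simp: less_Suc_eq)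
      then show ?thesis using S by (simp add: F_def)
    next
      case True
      let ?S = "S - {j}" let ?X = "set_encode (unhit w Q (S - {j}))"
      have sub: "?S \<subseteq> {..<j}" and eq: "insert j ?S = S" using S True by (auto simp: less_Suc_eq)
      have i: "independent_on ?W ?S" "unhit w Q S \<noteq> unhit w Q ?S"
        using ind[OF sub] S eq by auto
      have Z: "set_encode (unhit w Q S) = Z" using S by (simp add: set_decode_inverse)
      then have "?X \<noteq> Z" using i(2) enc(2) by metis
      then have "?X \<in> I" using shr[of ?S, unfolded eq] Z by (simp add: I_def enc)
      moreover have "?S \<in> F ?X" using sub i by (simp add: F_def enc)
      ultimately show ?thesis using eq by blast
    qed
  next
    fix S assume "S \<in> ?B"
    then consider "S \<in> F Z" | X S' where "X \<in> I" "S' \<in> F X" "S = insert j S'" by blast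
    then show "S \<in> ?A"
    proof cases
      case 1
      then show ?thesis by (auto simp: F_def)
    next
      case (2 X S')
      then have S': "S' \<subseteq> {..<j}" "independent_on ?W S'" "unhit w Q S' = set_decode X"
        by (auto simp: F_def)
      have X: "set_encode (unhit w Q S') = X" using S'(3) by (simp add: set_decode_inverse)
      have Z: "set_encode (unhit w Q S) = Z" using 2 shr[of S'] X by (simp add: I_def)
      have "unhit w Q S = set_decode Z" using enc(2)[of S] Z by simp
      moreover have "unhit w Q S \<noteq> unhit w Q S'" using X Z 2(1) by (auto simp: I_def)
      ultimately show ?thesis using S' 2(3) ind[OF S'(1)] by auto
    qed
  qed
  moreover have "card (insert j ` (\<Union>X\<in>I. F X)) = card (\<Union>X\<in>I. F X)"
    by (rule card_image) (auto simp: inj_on_def F_def dest!: notin)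
  moreover have "card (\<Union>X\<in>I. F X) = (\<Sum>X\<in>I. card (F X))"
  proof (rule card_UN_disjoint)
    show "finite I" by (rule finite_subset[of _ "{..<2 ^ Q}"]) (auto simp: I_def)
    show "\<forall>X\<in>I. \<forall>Y\<in>I. X \<noteq> Y \<longrightarrow> F X \<inter> F Y = {}"
    proof (intro ballI impI)
      fix X Y :: nat assume "X \<noteq> Y"
      then have "set_decode X \<noteq> set_decode Y" by (metis set_decode_inverse)
      then show "F X \<inter> F Y = {}" by (auto simp: F_def)
    qed
  qed (use finF in auto)
  moreover have "F Z \<inter> insert j ` (\<Union>X\<in>I. F X) = {}" by (auto simp: F_def)
  moreover have "finite (\<Union>X\<in>I. F X)"
    by (rule finite_subset[of _ "Pow {..<j}"]) (auto simp: F_def)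
  ultimately have "dp w Q (Suc j) Z = card (F Z) + (\<Sum>X\<in>I. card (F X))"
    using finF by (simp add: dp_def card_Un_disjoint)
  then show ?thesis by (simp add: dp_partial_def dp_def F_def I_def)
qed

text \<open>The zero word has index 0, so mask 1 is the state in which it alone survives.\<close>

lemma dp_final:
  fixes w :: "nat \<Rightarrow> nat \<Rightarrow> 'f::{field,finite}"
  assumes inj: "inj_on w {..<Q}" and 0: "w 0 = (\<lambda>_. 0)" "0 < Q"
  shows "dp w Q n 1 = card (info_sets n (w ` {..<Q}))"
proof -
  have "set_decode 1 = {0}"
    using set_encode_inverse[of "{0}"] by (simp add: set_encode_def)
  moreover have "unhit w Q S = {0} \<longleftrightarrow> vanishing (w ` {..<Q}) S = {\<lambda>_. 0}" for S
    using inj_on_image_eq_iff[OF inj, of "unhit w Q S" "{0}"] 0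
    by (simp add: vanishing_image subset_iff unhit_def)
  ultimately show ?thesis by (simp add: dp_def info_sets_eq)
qed

section \<open>Machine representation of field elements\<close>

abbreviation (input) aIn :: nat where "aIn \<equiv> 0"
abbreviation (input) aGen :: nat where "aGen \<equiv> 10"
abbreviation (input) aAlive :: nat where "aAlive \<equiv> 2"
abbreviation (input) aPivot :: nat where "aPivot \<equiv> 3"
abbreviation (input) aWord :: nat where "aWord \<equiv> 5"
abbreviation (input) aCount :: nat where "aCount \<equiv> 6"
abbreviation (input) aMul :: nat where "aMul \<equiv> 7"
abbreviation (input) aFma :: nat where "aFma \<equiv> 8"
abbreviation (input) aNonzero :: nat where "aNonzero \<equiv> 9"

abbreviation (input) rS :: nat where "rS \<equiv> 2"
abbreviation (input) rT :: nat where "rT \<equiv> 3"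
abbreviation (input) rOne :: nat where "rOne \<equiv> 4"
abbreviation (input) rRows :: nat where "rRows \<equiv> 5"
abbreviation (input) rCols :: nat where "rCols \<equiv> 6"
abbreviation (input) rEntries :: nat where "rEntries \<equiv> 7"
abbreviation (input) rZero :: nat where "rZero \<equiv> 8"
abbreviation (input) rNeg :: nat where "rNeg \<equiv> 9"
abbreviation (input) rField :: nat where "rField \<equiv> 10"
abbreviation (input) rI :: nat where "rI \<equiv> 11"
abbreviation (input) rL :: nat where "rL \<equiv> 12"
abbreviation (input) rJ :: nat where "rJ \<equiv> 13"
abbreviation (input) rA :: nat where "rA \<equiv> 14"
abbreviation (input) rX :: nat where "rX \<equiv> 15"
abbreviation (input) rRow :: nat where "rRow \<equiv> 16"
abbreviation (input) rFound :: nat where "rFound \<equiv> 17"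
abbreviation (input) rGen :: nat where "rGen \<equiv> 18"
abbreviation (input) rAcc :: nat where "rAcc \<equiv> 19"
abbreviation (input) rPiv :: nat where "rPiv \<equiv> 20"
abbreviation (input) rPivDot :: nat where "rPivDot \<equiv> 21"
abbreviation (input) rFac :: nat where "rFac \<equiv> 22"
abbreviation (input) rU :: nat where "rU \<equiv> 23"
abbreviation (input) rV :: nat where "rV \<equiv> 24"
abbreviation (input) rWords :: nat where "rWords \<equiv> 25"
abbreviation (input) rOld :: nat where "rOld \<equiv> 26"
abbreviation (input) rSrc :: nat where "rSrc \<equiv> 27"
abbreviation (input) rDst :: nat where "rDst \<equiv> 28"
abbreviation (input) rMasks :: nat where "rMasks \<equiv> 29"
abbreviation (input) rMask :: nat where "rMask \<equiv> 30"
abbreviation (input) rTarget :: nat where "rTarget \<equiv> 31"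
abbreviation (input) rBit :: nat where "rBit \<equiv> 32"
abbreviation (input) rPos :: nat where "rPos \<equiv> 33"
abbreviation (input) rHalf :: nat where "rHalf \<equiv> 34"
abbreviation (input) rOdd :: nat where "rOdd \<equiv> 35"
abbreviation (input) rUnit :: nat where "rUnit \<equiv> 36"
abbreviation (input) rNumGens :: nat where "rNumGens \<equiv> 37"

text \<open>The recursion unrolls at program construction: the result is straight-line code whose
  length for the tables below depends only on the fixed field.\<close>

fun fill :: "nat \<Rightarrow> (nat \<Rightarrow> nat) \<Rightarrow> nat \<Rightarrow> com" where
  "fill a h 0 = Skip"
| "fill a h (Suc k) = (fill a h k ;; Const rS k ;; Const rT (h k) ;; Store a rS rT)"

lemma wp_fill:
  assumes "\<And>r'. (\<And>x. x \<notin> {rS, rT} \<Longrightarrow> r' x = r x) \<Longrightarrow>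
    Q (3 * k + 1) (r', m(a := (\<lambda>i. if i < k then h i else m a i)))"
  shows "wp (fill a h k) Q (r, m)"
  using assms
proof (induction k arbitrary: Q)
  case 0
  have "m(a := (\<lambda>i. if i < 0 then h i else m a i)) = m" by (auto simp: fun_eq_iff)
  then show ?case using "0"[of r] by simp
next
  case (Suc k)
  show ?case unfolding fill.simps wp_Seq
  proof (rule Suc.IH, goal_cases)
    case (1 r')
    let ?m = "m(a := (\<lambda>i. if i < k then h i else m a i))" and ?r = "r'(rS := k, rT := h k)"
    have mem: "?m(a := (?m a)(?r rS := ?r rT)) = m(a := (\<lambda>i. if i < Suc k then h i else m a i))"
      by (auto simp: fun_eq_iff)
    have "Q (3 * Suc k + 1) (r'(rS := k, rT := h k), m(a := (\<lambda>i. if i < Suc k then h i else m a i)))"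
      by (rule Suc.prems) (use 1 in auto)
    then show ?case unfolding wp_basic mem by (simp add: numeral_eq_Suc)
  qed
qed

lemma row_major_inj:
  fixes l l' j j' n :: nat
  assumes "j < n" "j' < n"
  shows "l * n + j = l' * n + j' \<longleftrightarrow> l = l' \<and> j = j'"
proof
  assume eq: "l * n + j = l' * n + j'"
  have "l = (l * n + j) div n" "l' = (l' * n + j') div n" using assms by auto
  with eq have "l = l'" by metis
  with eq show "l = l' \<and> j = j'" by simp
qed simp

locale field_coding =
  fixes code :: "'f::{field,finite} \<Rightarrow> nat" and q :: nat
  assumes bij: "bij_betw code UNIV {0..<q}"
begin

lemma q_eq: "q = card (UNIV :: 'f set)"
  using bij_betw_same_card[OF bij] by simp

lemma code_less [simp]: "code x < q"
  using bij_betwE[OF bij] by auto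

lemma code_eq_iff [simp]: "code x = code y \<longleftrightarrow> x = y"
  using bij_betw_imp_inj_on[OF bij] by (auto dest: injD)

definition decode :: "nat \<Rightarrow> 'f" where
  "decode = inv_into UNIV code"

lemma decode_code [simp]: "decode (code x) = x"
  using inv_into_f_f[OF bij_betw_imp_inj_on[OF bij]] by (simp add: decode_def)

lemma code_decode [simp]: "y < q \<Longrightarrow> code (decode y) = y"
  using bij_betw_imp_surj_on[OF bij] unfolding decode_def by (intro f_inv_into_f) auto

lemma q_ge_2: "q \<ge> 2"
  unfolding q_eq by (rule card_field_ge_2)

lemma q_pos [simp]: "0 < q"
  using q_ge_2 by simp

definition valid :: "(nat \<Rightarrow> nat) \<Rightarrow> bool" where
  "valid M \<longleftrightarrow> (\<forall>x. M x < q)"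

text \<open>Views an array from address \<open>b\<close> on as a row-major matrix with
  \<open>n\<close> columns. The default 0 makes every row an element of
  \<open>words {..<n}\<close>.\<close>

definition rd :: "(nat \<Rightarrow> nat) \<Rightarrow> nat \<Rightarrow> nat \<Rightarrow> nat \<Rightarrow> nat \<Rightarrow> 'f" where
  "rd M b n i j = (if j < n then decode (M (b + i * n + j)) else 0)"

lemma valid_upd: "valid M \<Longrightarrow> valid (M(x := code v))"
  by (simp add: valid_def)

lemma rd_read: "valid M \<Longrightarrow> j < n \<Longrightarrow> M (b + i * n + j) = code (rd M b n i j)"
  by (simp add: valid_def rd_def)

lemma rd_upd:
  assumes "j < n"
  shows "rd (M(b + l * n + j := code v)) b n = (rd M b n)(l := (rd M b n l)(j := v))"
proof (intro ext)
  fix i k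
  show "rd (M(b + l * n + j := code v)) b n i k = ((rd M b n)(l := (rd M b n l)(j := v))) i k"
  proof (cases "k < n")
    case True
    then have "b + i * n + k = b + l * n + j \<longleftrightarrow> i = l \<and> k = j"
      using row_major_inj[OF True assms] by simp
    then show ?thesis using True by (auto simp: rd_def)
  qed (use assms in \<open>auto simp: rd_def\<close>)
qed

lemma rd_outside: "\<not> j < n \<Longrightarrow> rd M b n i j = 0"
  by (simp add: rd_def)

text \<open>
  Multiplication is not available at unit cost, so field arithmetic is done by look-up: the table
  \<open>fma\<close> is indexed by the three base \<open>q\<close> digits of the codes of \<open>x\<close>, \<open>a\<close> and \<open>b\<close>.
\<close>

definition tables :: "(nat \<Rightarrow> nat) \<Rightarrow> (nat \<Rightarrow> nat) \<Rightarrow> (nat \<Rightarrow> nat) \<Rightarrow> bool" where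
  "tables mul fma nz \<longleftrightarrow> (\<forall>x<q * q. mul x = q * x) \<and>
    (\<forall>x a b. fma (q * (q * code x + code a) + code b) = code (x + a * b)) \<and>
    (\<forall>x. nz (code x) = (if x = 0 then 0 else 1))"

text \<open>Horner's rule for the table index, where multiplication by \<open>q\<close> is itself a
  look-up.\<close>

definition Fma :: "nat \<Rightarrow> nat \<Rightarrow> nat \<Rightarrow> nat \<Rightarrow> com" where
  "Fma d x a b = Load rS aMul x ;; Add rS rS a ;; Load rS aMul rS ;; Add rS rS b ;; Load d aFma rS"

lemma written_Fma [simp]:
  "written_regs (Fma d x a b) = {rS, d}" "written_arrays (Fma d x a b) = {}"
  by (auto simp: Fma_def)

lemma digits_less: "u < q \<Longrightarrow> v < q \<Longrightarrow> q * u + v < q * q"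
proof -
  assume "u < q" "v < q"
  then have "q * u + v < q * Suc u" by simp
  also have "\<dots> \<le> q * q" using \<open>u < q\<close> by (intro mult_le_mono2) simp
  finally show ?thesis .
qed

lemma wp_Fma:
  assumes T: "tables (m aMul) (m aFma) (m aNonzero)"
    and r: "r x = code u" "r a = code v" "r b = code w" and ne: "a \<noteq> rS" "b \<noteq> rS"
  shows "wp (Fma d x a b) Q (r, m) =
    Q 5 (r(rS := q * (q * code u + code v) + code w, d := code (u + v * w)), m)"
proof -
  have "m aMul (code u) = q * code u"
    using T digits_less[of 0 "code u"] by (simp add: tables_def)
  moreover have "m aMul (q * code u + code v) = q * (q * code u + code v)"
    using T digits_less[of "code u" "code v"] by (simp add: tables_def)
  moreover have "m aFma (q * (q * code u + code v) + code w) = code (u + v * w)"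
    using T by (simp add: tables_def)
  ultimately show ?thesis using r ne by (simp add: Fma_def numeral_eq_Suc)
qed

definition Setup :: com where
  "Setup = fill aMul (\<lambda>i. q * i) (q * q) ;;
    fill aFma (\<lambda>i. code (decode (i div (q * q)) + decode (i div q mod q) * decode (i mod q))) (q * (q * q)) ;;
    fill aNonzero (\<lambda>i. if decode i = 0 then 0 else 1) q ;;
    Const rOne 1 ;; Const rZero (code 0) ;; Const rNeg (code (- 1)) ;; Const rUnit (code 1) ;; Const rField q"

definition constants :: "(nat \<Rightarrow> nat) \<Rightarrow> bool" where
  "constants r \<longleftrightarrow> r rOne = 1 \<and> r rZero = code 0 \<and> r rNeg = code (- 1) \<and> r rUnit = code 1 \<and> r rField = q"

lemma wp_Setup:
  assumes post: "\<And>t r' m'. t \<le> 3 * (q * q) + 3 * (q * (q * q)) + 3 * q + 8 \<Longrightarrow>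
    tables (m' aMul) (m' aFma) (m' aNonzero) \<Longrightarrow> constants r' \<Longrightarrow>
    (\<And>x. x \<notin> {rS, rT, rOne, rZero, rNeg, rField, rUnit} \<Longrightarrow> r' x = r x) \<Longrightarrow>
    (\<And>a. a \<notin> {aMul, aFma, aNonzero} \<Longrightarrow> m' a = m a) \<Longrightarrow>
    Q t (r', m')"
  shows "wp Setup Q (r, m)"
  unfolding Setup_def wp_Seq
proof (rule wp_fill, rule wp_fill, rule wp_fill, goal_cases)
  case (1 r1 r2 r3)
  let ?fma = "\<lambda>i. code (decode (i div (q * q)) + decode (i div q mod q) * decode (i mod q))"
  let ?m1 = "m(aMul := \<lambda>i. if i < q * q then q * i else m aMul i)"
  let ?m2 = "?m1(aFma := \<lambda>i. if i < q * (q * q) then ?fma i else ?m1 aFma i)"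
  let ?m3 = "?m2(aNonzero := \<lambda>i. if i < q then if decode i = 0 then 0 else 1 else ?m2 aNonzero i)"
  let ?r = "r3(rOne := 1, rZero := code 0, rNeg := code (- 1), rUnit := code 1, rField := q)"
  have "(q * (q * code x + code a) + code b) < q * (q * q)" for x a b
  proof -
    have "q * (q * code x + code a) + code b < q * Suc (q * code x + code a)" by simp
    also have "\<dots> \<le> q * (q * q)"
      using digits_less[OF code_less code_less] by (intro mult_le_mono2) (simp add: Suc_le_eq)
    finally show ?thesis .
  qed
  moreover have "?fma (q * (q * code x + code a) + code b) = code (x + a * b)" for x a b
  proof -
    have 1: "(q * (q * code x + code a) + code b) div q = q * code x + code a" by simp
    have "(q * (q * code x + code a) + code b) div (q * q) = code x"
      unfolding div_mult2_eq 1 by simp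
    then show ?thesis unfolding 1 by simp
  qed
  ultimately have "tables (?m3 aMul) (?m3 aFma) (?m3 aNonzero)"
    by (simp add: tables_def del: mult.assoc)
  then have "Q t (?r, ?m3)" if "t \<le> 3 * (q * q) + 3 * (q * (q * q)) + 3 * q + 8" for t
  proof (rule post[OF that])
    show "constants ?r" by (simp add: constants_def)
    show "?r x = r x" if "x \<notin> {rS, rT, rOne, rZero, rNeg, rField, rUnit}" for x
      using that 1 by simp
  qed auto
  then show ?case unfolding wp_Seq wp_basic by this simp
qed

definition Dot :: com where
  "Dot = Copy rAcc rZero ;; For rJ rCols (Add rU rRow rJ ;; Load rU aIn rU ;;
    Add rV rGen rJ ;; Load rV aGen rV ;; Fma rAcc rAcc rU rV)"

lemma written_Dot [simp]: "written_regs Dot = {1, rS, rJ, rU, rV, rAcc}" "written_arrays Dot = {}"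
  by (auto simp: Dot_def)

lemma wp_Dot:
  assumes T: "tables (m aMul) (m aFma) (m aNonzero)" and v: "valid (m aIn)" "valid (m aGen)"
    and r: "constants r" "r rCols = n" "r rRow = b + i * n" "r rGen = l * n"
    and post: "\<And>t r'. t \<le> n * 13 + 4 \<Longrightarrow>
      r' rAcc = code (dot n (rd (m aIn) b n i) (rd (m aGen) 0 n l)) \<Longrightarrow>
      (\<And>x. x \<notin> {1, rS, rJ, rU, rV, rAcc} \<Longrightarrow> r' x = r x) \<Longrightarrow> Q t (r', m)"
  shows "wp Dot Q (r, m)"
  unfolding Dot_def wp_Seq wp_basic
proof (rule wp_For[where N = n and T = 9 and I = "\<lambda>k r' m'. m' = m \<and>
    r' rAcc = code (\<Sum>j<k. rd (m aIn) b n i j * rd (m aGen) 0 n l j)"], goal_cases)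
  case (3 k r' m')
  have "m aIn (b + i * n + k) = code (rd (m aIn) b n i k)"
    "m aGen (l * n + k) = code (rd (m aGen) 0 n l k)"
    using rd_read[OF v(1), of k n b i] rd_read[OF v(2), of k n 0 l] 3(1) by simp_all
  moreover have "r' rRow = b + i * n" "r' rGen = l * n" "r' rJ = k" "m' = m" using 3 r by auto
  ultimately show ?case using 3(2)
    by (simp add: T wp_Fma[where u = "\<Sum>j<k. rd (m aIn) b n i j * rd (m aGen) 0 n l j"
      and v = "rd (m aIn) b n i k" and w = "rd (m aGen) 0 n l k"])
next
  case (6 t r' m')
  then have m': "m' = m" by simp
  show ?case unfolding m' by (rule post) (use 6 in \<open>auto simp: dot_def\<close>)
qed (use r in \<open>auto simp: constants_def\<close>)

end

text \<open>The first unary block starts at address 0, so \<open>rRows\<close> is both its counter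
  and its reading position. The second block starts elsewhere and needs \<open>rEntries\<close> as a
  separate position, which ends just behind the second terminator.\<close>

definition Parse :: com where
  "Parse = Load 1 aIn rRows ;;
    While_Nonzero 1 (Add rRows rRows rOne ;; Load 1 aIn rRows) ;;
    Add rEntries rRows rOne ;; Load 1 aIn rEntries ;;
    While_Nonzero 1 (Add rEntries rEntries rOne ;; Add rCols rCols rOne ;; Load 1 aIn rEntries) ;;
    Add rEntries rEntries rOne"

lemma agree_regs: "agree p s s' \<Longrightarrow> x \<notin> written_regs p \<Longrightarrow> fst s' x = fst s x"
  by (simp add: agree_def)

lemma wp_Parse:
  assumes r: "r rOne = 1" "r rRows = 0" "r rCols = 0"
    and w: "\<And>i. i < M \<Longrightarrow> m aIn i \<noteq> 0" "m aIn M = 0"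
      "\<And>j. j < N \<Longrightarrow> m aIn (M + 1 + j) \<noteq> 0" "m aIn (M + 1 + N) = 0"
    and post: "\<And>t r'. t \<le> M * 3 + N * 4 + 6 \<Longrightarrow> r' rRows = M \<Longrightarrow> r' rCols = N \<Longrightarrow>
      r' rEntries = M + N + 2 \<Longrightarrow>
      (\<And>x. x \<notin> {1, rRows, rCols, rEntries} \<Longrightarrow> r' x = r x) \<Longrightarrow> Q t (r', m)"
  shows "wp Parse Q (r, m)"
  unfolding Parse_def wp_Seq wp_basic
proof (rule wp_While[where N = M and T = 2 and
      I = "\<lambda>k s. snd s = m \<and> fst s rRows = k \<and> fst s 1 = m aIn k"], goal_cases)
  case 1
  show ?case using r by simp
next
  case (2 k s)
  obtain r1 m1 where s: "s = (r1, m1)" by (cases s)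
  have "r1 rOne = 1" using agree_regs[OF 2(3), of rOne] r by (simp add: s)
  then show ?case using 2 w(1) by (simp add: s)
next
  case (3 s)
  then show ?case using w by simp
next
  case (4 t s)
  obtain r1 m1 where s: "s = (r1, m1)" by (cases s)
  have m1: "m1 = m" and r1: "r1 rRows = M" using 4 by (simp_all add: s)
  have fr: "r1 x = r x" if "x \<notin> {1, rRows}" for x
    using agree_regs[OF 4(3), of x] that by (simp add: s)
  have r1': "r1 rCols = 0" "r1 rOne = 1" using r fr by auto
  show ?case unfolding s m1 wp_basic
  proof (rule wp_While[where N = N and T = 3 and
      I = "\<lambda>k s. snd s = m \<and> fst s rCols = k \<and> fst s rEntries = M + 1 + k \<and> fst s 1 = m aIn (M + 1 + k)"],
      goal_cases)
    case 1
    show ?case using r1 r1' by simp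
  next
    case (2 k s)
    obtain r2 m2 where s: "s = (r2, m2)" by (cases s)
    have "r2 rOne = 1" using agree_regs[OF 2(3), of rOne] r1' by (simp add: s)
    then show ?case using 2 w(3)[of k] by (simp add: s)
  next
    case (3 s)
    then show ?case using w by simp
  next
    case (4 u s)
    obtain r2 m2 where s: "s = (r2, m2)" by (cases s)
    have m2: "m2 = m" using 4 by (simp add: s)
    have fr2: "r2 x = r1 x" if "x \<notin> {1, rCols, rEntries}" for x
      using agree_regs[OF 4(3), of x] that by (simp add: s)
    show ?case unfolding s m2 wp_basic
      by (rule post) (use 4 \<open>t \<le> M * (2 + 1) + 1\<close> r1 r1' fr2 fr in \<open>auto simp: s\<close>)
  qed
qed

section \<open>The elimination program\<close>

context field_coding
begin

lemmas rd_upd0 = rd_upd[where b = 0, simplified]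
  and rd_read0 = rd_read[where b = 0, simplified]

text \<open>Fresh memory holds the number 0, which may differ from \<open>code 0\<close>; zero
  vectors have to be written explicitly.\<close>

definition Clear :: com where
  "Clear = For rJ rCols (Add rU rGen rJ ;; Store aGen rU rZero)"

lemma written_Clear [simp]: "written_regs Clear = {1, rJ, rU}" "written_arrays Clear = {aGen}"
  by (auto simp: Clear_def)

lemma wp_Clear:
  assumes v: "valid (m aGen)" and r: "constants r" "r rCols = n" "r rGen = l * n"
    and post: "\<And>t r' M. t \<le> n * 6 + 3 \<Longrightarrow> valid M \<Longrightarrow>
      rd M 0 n = (rd (m aGen) 0 n)(l := \<lambda>_. 0) \<Longrightarrow>
      (\<And>x. x \<notin> {1, rJ, rU} \<Longrightarrow> r' x = r x) \<Longrightarrow> Q t (r', m(aGen := M))"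
  shows "wp Clear Q (r, m)"
  unfolding Clear_def
proof (rule wp_For[where N = n and T = 2 and I = "\<lambda>k r' m'. valid (m' aGen) \<and>
    rd (m' aGen) 0 n = (rd (m aGen) 0 n)(l := \<lambda>j. if j < k then 0 else rd (m aGen) 0 n l j)"], goal_cases)
  case (3 k r' m')
  have reg: "r' rGen = l * n" "r' rZero = code 0" "r' rJ = k" using 3 r by (auto simp: constants_def)
  have "((rd (m aGen) 0 n)(l := \<lambda>j. if j < k then 0 else rd (m aGen) 0 n l j))
      (l := (\<lambda>j. if j < k then 0 else rd (m aGen) 0 n l j)(k := 0)) =
    (rd (m aGen) 0 n)(l := \<lambda>j. if j < Suc k then 0 else rd (m aGen) 0 n l j)"
    by (auto simp: fun_eq_iff less_Suc_eq)
  then show ?case using 3(1,2) by (simp add: reg valid_upd rd_upd0)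
next
  case (6 t r' m')
  then have m': "m' = m(aGen := m' aGen)" by (auto simp: fun_eq_iff)
  have "(\<lambda>j. if j < n then 0 else rd (m aGen) 0 n l j) = (\<lambda>_. 0)" by (auto simp: rd_outside)
  then have "Q t (r', m(aGen := m' aGen))" using 6 by (intro post) auto
  then show ?case using m' by simp
qed (use v r in \<open>auto simp: constants_def\<close>)

definition Units :: com where
  "Units = Const rGen 0 ;; For rL rCols (Store aAlive rL rOne ;; Clear ;;
    Add rU rGen rL ;; Store aGen rU rUnit ;; Add rGen rGen rCols)"

lemma written_Units [simp]:
  "written_regs Units = {1, rL, rJ, rU, rGen}" "written_arrays Units = {aAlive, aGen}"
  by (auto simp: Units_def)

lemma wp_Units:
  assumes v: "valid (m aGen)" and r: "constants r" "r rCols = n"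
    and post: "\<And>t r' M L. t \<le> n * (n * 6 + 11) + 4 \<Longrightarrow> valid M \<Longrightarrow>
      (\<And>l. l < n \<Longrightarrow> rd M 0 n l = (\<lambda>j. if j = l then 1 else 0)) \<Longrightarrow>
      (\<And>l. l < n \<Longrightarrow> L l = 1) \<Longrightarrow>
      (\<And>x. x \<notin> {1, rL, rJ, rU, rGen} \<Longrightarrow> r' x = r x) \<Longrightarrow> Q t (r', m(aGen := M, aAlive := L))"
  shows "wp Units Q (r, m)"
  unfolding Units_def wp_Seq wp_basic
proof (rule wp_For[where N = n and T = "n * 6 + 7" and I = "\<lambda>k r' m'. valid (m' aGen) \<and>
    r' rGen = k * n \<and> (\<forall>l<k. rd (m' aGen) 0 n l = (\<lambda>j. if j = l then 1 else 0) \<and> m' aAlive l = 1)"], goal_cases)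
  case (3 k r1 m1)
  have reg: "constants r1" "r1 rCols = n" "r1 rL = k" "r1 rGen = k * n"
    using 3 r by (auto simp: constants_def)
  show ?case unfolding wp_Seq wp_basic
  proof (rule wp_Clear[where n = n and l = k], goal_cases)
    case (5 t r2 M)
    have reg2: "r2 rCols = n" "r2 rL = k" "r2 rGen = k * n" "r2 rUnit = code 1"
      using 5 reg by (auto simp: constants_def)
    have "(\<lambda>_. 0 :: 'f)(k := 1) = (\<lambda>j. if j = k then 1 else 0)" by auto
    then show ?case using 5(1,2,3) 3(1,2) reg reg2
      by (auto simp: rd_upd0 valid_upd constants_def less_Suc_eq)
  qed (use 3 reg in auto)
next
  case (6 t r' m')
  then have m': "m' = m(aGen := m' aGen, aAlive := m' aAlive)" by (auto simp: fun_eq_iff)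
  have "Q (1 + t) (r', m(aGen := m' aGen, aAlive := m' aAlive))"
    by (rule post) (use 6 in \<open>auto simp: algebra_simps\<close>)
  then show ?case using m' by simp
qed (use v r in auto)

text \<open>Cross-multiplication avoids inverses: with \<open>d\<close> and \<open>e\<close> the
  products of the row with the current generator and with the pivot, the combination
  \<open>e * g l - d * g p\<close> is orthogonal to the row and keeps the nonzero factor
  \<open>e\<close> on \<open>g l\<close>.\<close>

definition Update :: com where
  "Update = Fma rFac rZero rNeg rAcc ;; For rJ rCols (Add rV rGen rJ ;; Load rU aGen rV ;;
    Fma rU rZero rPivDot rU ;; Add rT rPiv rJ ;; Load rT aGen rT ;; Fma rU rU rFac rT ;;
    Store aGen rV rU)"

lemma written_Update [simp]:
  "written_regs Update = {1, rS, rT, rJ, rU, rV, rFac}" "written_arrays Update = {aGen}"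
  by (auto simp: Update_def)

lemma wp_Update:
  assumes T: "tables (m aMul) (m aFma) (m aNonzero)" and v: "valid (m aGen)"
    and r: "constants r" "r rCols = n" "r rGen = l * n" "r rPiv = p * n" "p \<noteq> l"
      "r rAcc = code d" "r rPivDot = code e"
    and post: "\<And>t r' M. t \<le> n * 19 + 8 \<Longrightarrow> valid M \<Longrightarrow>
      rd M 0 n = (rd (m aGen) 0 n)
        (l := \<lambda>j. e * rd (m aGen) 0 n l j + (- d) * rd (m aGen) 0 n p j) \<Longrightarrow>
      (\<And>x. x \<notin> {1, rS, rT, rJ, rU, rV, rFac} \<Longrightarrow> r' x = r x) \<Longrightarrow> Q t (r', m(aGen := M))"
  shows "wp Update Q (r, m)"
proof -
  let ?g = "rd (m aGen) 0 n"
  let ?h = "\<lambda>k. ?g(l := \<lambda>j. if j < k then e * ?g l j + (- d) * ?g p j else ?g l j)"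
  have r0: "r rZero = code 0" "r rNeg = code (- 1)" using r by (simp_all add: constants_def)
  have fma: "wp (Fma rFac rZero rNeg rAcc) Q (r, m) =
      Q 5 (r(rS := q * (q * code 0 + code (- 1)) + code d, rFac := code (0 + (- 1) * d)), m)" for Q
    by (rule wp_Fma) (use T r0 r in auto)
  show ?thesis unfolding Update_def wp_Seq fma
  proof (rule wp_For[where N = n and T = 15 and I = "\<lambda>k r' m'. valid (m' aGen) \<and> rd (m' aGen) 0 n = ?h k"],
      goal_cases)
    case (3 k r' m')
    have reg: "r' rGen = l * n" "r' rPiv = p * n" "r' rZero = code 0" "r' rJ = k"
      "r' rPivDot = code e" "r' rFac = code (- d)"
      using 3 r by (auto simp: constants_def)
    have T': "tables (m' aMul) (m' aFma) (m' aNonzero)" using 3 T by auto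
    have rdl: "m' aGen (l * n + k) = code (?g l k)" "m' aGen (p * n + k) = code (?g p k)"
      using rd_read0[of "m' aGen" k n l] rd_read0[of "m' aGen" k n p] 3(1,2) r(5) by auto
    have "(?h k)(l := (?h k l)(k := e * ?g l k + (- d) * ?g p k)) = ?h (Suc k)"
      by (auto simp: fun_eq_iff less_Suc_eq)
    then show ?case using 3(1,2)
      by (simp add: reg rdl T' valid_upd rd_upd0
        wp_Fma[where u = 0 and v = e and w = "?g l k"]
        wp_Fma[where u = "e * ?g l k" and v = "- d" and w = "?g p k"])
  next
    case (6 t r' m')
    then have m': "m' = m(aGen := m' aGen)" by (auto simp: fun_eq_iff)
    have "?h n = ?g(l := \<lambda>j. e * ?g l j + (- d) * ?g p j)"
      by (auto simp: fun_eq_iff rd_outside)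
    then have "Q (5 + t) (r', m(aGen := m' aGen))" using 6 by (intro post) auto
    then show ?case using m' by simp
  qed (use v r in auto)
qed

text \<open>
  The pivot is the first live generator not orthogonal to the row, so the generators before it
  need no correction and one pass suffices.
\<close>

definition Gen_Step :: com where
  "Gen_Step = Load rS aAlive rL ;; If_Nonzero rS
      (Dot ;; Load rS aNonzero rAcc ;; If_Nonzero rS
        (If_Nonzero rFound Update
          (Copy rPiv rGen ;; Copy rPivDot rAcc ;; Copy rFound rOne ;; Const rS 0 ;; Store aAlive rL rS))
        Skip)
      Skip ;;
    Add rGen rGen rCols"

lemma written_Gen_Step [simp]:
  "written_regs Gen_Step =
    {1, rS, rT, rJ, rU, rV, rFac, rAcc, rPiv, rPivDot, rFound, rGen}"
  "written_arrays Gen_Step = {aGen, aAlive}"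
  by (auto simp: Gen_Step_def)

text \<open>Here \<open>g\<close>, \<open>L\<close> and \<open>d\<close> describe the generators
  before the scan of the row. Live generators preceding the pivot were orthogonal to the row, so the
  condition \<open>d l \<noteq> 0\<close> leaves them unchanged.\<close>

definition scan_inv :: "nat \<Rightarrow> (nat \<Rightarrow> nat \<Rightarrow> 'f) \<Rightarrow> (nat \<Rightarrow> nat) \<Rightarrow> (nat \<Rightarrow> 'f) \<Rightarrow> nat \<Rightarrow>
    (nat \<Rightarrow> nat) \<Rightarrow> (nat \<Rightarrow> nat \<Rightarrow> nat) \<Rightarrow> bool" where
  "scan_inv n g L d k r m \<longleftrightarrow> valid (m aGen) \<and> r rGen = k * n \<and>
    (r rFound = 0 \<and> rd (m aGen) 0 n = g \<and> m aAlive = L \<and> (\<forall>l<k. L l \<noteq> 0 \<longrightarrow> d l = 0) \<or>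
     (\<exists>p<k. L p \<noteq> 0 \<and> d p \<noteq> 0 \<and> r rFound = 1 \<and> r rPiv = p * n \<and> r rPivDot = code (d p) \<and>
       m aAlive = L(p := 0) \<and>
       rd (m aGen) 0 n = (\<lambda>l. if l < k \<and> l \<noteq> p \<and> L l \<noteq> 0 \<and> d l \<noteq> 0
         then \<lambda>j. d p * g l j + (- d l) * g p j else g l)))"

lemma wp_Gen_Step:
  assumes T: "tables (m aMul) (m aFma) (m aNonzero)" and v: "valid (m aIn)"
    and r: "constants r" "r rCols = n" "r rRow = b + i * n" "r rL = k"
    and d: "\<And>l. d l = dot n (rd (m aIn) b n i) (g l)"
    and inv: "scan_inv n g L d k r m"
  shows "wp Gen_Step (\<lambda>t s. t \<le> n * 32 + 20 \<and> scan_inv n g L d (Suc k) (fst s) (snd s)) (r, m)"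
proof -
  have vG: "valid (m aGen)" and rG: "r rGen = k * n" using inv by (auto simp: scan_inv_def)
  \<comment> \<open>The scan has only touched generators below \<open>k\<close>, so generator
    \<open>k\<close> is still the original one.\<close>
  have alive: "m aAlive k = L k" and gk: "rd (m aGen) 0 n k = g k"
    using inv by (auto simp: scan_inv_def)
  show ?thesis
  proof (cases "L k = 0")
    case True
    then show ?thesis using inv r rG alive
      by (auto simp: Gen_Step_def scan_inv_def less_Suc_eq fun_eq_iff; fastforce)
  next
    case alive_k: False
    have dot: "wp Dot (\<lambda>t s. \<exists>r'. s = (r', m) \<and> t \<le> n * 13 + 4 \<and> r' rAcc = code (d k) \<and>
      (\<forall>x. x \<notin> {1, rS, rJ, rU, rV, rAcc} \<longrightarrow> r' x = r x)) (r(rS := L k), m)"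
      by (rule wp_Dot[where n = n and b = b and i = i and l = k])
        (use T v vG r rG d gk in \<open>auto simp: constants_def\<close>)
    show ?thesis
    proof (simp add: Gen_Step_def alive alive_k r(4), rule wp_mono[OF dot], goal_cases)
      case (1 t s)
      then obtain r' where s: "s = (r', m)" and t: "t \<le> n * 13 + 4" and acc: "r' rAcc = code (d k)"
        and fr: "\<And>x. x \<notin> {1, rS, rJ, rU, rV, rAcc} \<Longrightarrow> r' x = r x"
        by blast
      have nz: "m aNonzero (code (d k)) = (if d k = 0 then 0 else 1)" using T by (simp add: tables_def)
      have reg: "r' rCols = n" "r' rL = k" "r' rGen = k * n" "r' rFound = r rFound"
        "r' rPiv = r rPiv" "r' rPivDot = r rPivDot" "r' rOne = 1" and c: "constants r'"
        using r rG by (simp_all add: fr constants_def)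
      consider "d k = 0" | "d k \<noteq> 0" "r rFound = 0" | "d k \<noteq> 0" "r rFound \<noteq> 0" by blast
      then show ?case
      proof cases
        case 1
        have "scan_inv n g L d (Suc k) (r'(rS := 0, rGen := k * n + n)) m"
          using inv 1 reg unfolding scan_inv_def
          by (elim conjE disjE exE) (auto simp: less_Suc_eq fun_eq_iff intro!: exI)
        then show ?thesis using t 1 nz by (simp add: s acc reg)
      next
        case 2
        have "scan_inv n g L d (Suc k)
            (r'(rPiv := k * n, rPivDot := code (d k), rFound := 1, rS := 0, rGen := k * n + n))
            (m(aAlive := (m aAlive)(k := 0)))"
          using inv 2 reg alive_k unfolding scan_inv_def
          by (auto simp: less_Suc_eq fun_eq_iff)
        then show ?thesis using t 2 by (simp add: s acc nz reg)
      next
        case 3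
        then obtain p where p: "p < k" "L p \<noteq> 0" "d p \<noteq> 0" "r rFound = 1" "r rPiv = p * n"
          "r rPivDot = code (d p)" "m aAlive = L(p := 0)"
          "rd (m aGen) 0 n = (\<lambda>l. if l < k \<and> l \<noteq> p \<and> L l \<noteq> 0 \<and> d l \<noteq> 0
            then \<lambda>j. d p * g l j + (- d l) * g p j else g l)"
          using inv by (auto simp: scan_inv_def)
        have gp: "rd (m aGen) 0 n p = g p" using p by simp
        have "wp Update (\<lambda>t s. \<exists>r2 M. s = (r2, m(aGen := M)) \<and> t \<le> n * 19 + 8 \<and> valid M \<and>
            rd M 0 n = (rd (m aGen) 0 n)(k := \<lambda>j. d p * g k j + (- d k) * g p j) \<and>
            (\<forall>x. x \<notin> {1, rS, rT, rJ, rU, rV, rFac} \<longrightarrow> r2 x = r' x)) (r'(rS := 1), m)"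
          by (rule wp_Update[where n = n and l = k and p = p and d = "d k" and e = "d p"])
            (use T vG c reg p acc gp gk in \<open>auto simp: constants_def\<close>)
        then show ?thesis
        proof (simp add: s acc nz reg 3, elim wp_mono, goal_cases)
          case (1 u s2)
          then obtain r2 M where s2: "s2 = (r2, m(aGen := M))" and u: "u \<le> n * 19 + 8" and M: "valid M"
            and rdM: "rd M 0 n = (rd (m aGen) 0 n)(k := \<lambda>j. d p * g k j + (- d k) * g p j)"
            and fr2: "\<And>x. x \<notin> {1, rS, rT, rJ, rU, rV, rFac} \<Longrightarrow> r2 x = r' x"
            by auto
          have reg2: "r2 rCols = n" "r2 rGen = k * n" "r2 rFound = 1" "r2 rPiv = p * n"
            "r2 rPivDot = code (d p)"
            using reg p by (simp_all add: fr2)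
          have "rd M 0 n = (\<lambda>l. if l < Suc k \<and> l \<noteq> p \<and> L l \<noteq> 0 \<and> d l \<noteq> 0
            then \<lambda>j. d p * g l j + (- d l) * g p j else g l)"
            unfolding rdM p(8) using p(1) alive_k 3(1) by (auto simp: fun_eq_iff less_Suc_eq)
          then have "scan_inv n g L d (Suc k) (r2(rGen := k * n + n)) (m(aGen := M))"
            using M p reg2 unfolding scan_inv_def by (auto intro!: exI[of _ p])
          then show ?case using t u by (simp add: s2 reg2)
        qed
      qed
    qed
  qed
qed


text \<open>Row and generator addresses advance by adding \<open>rCols\<close>, as the machine
  cannot multiply.\<close>

definition Row_Step :: com where
  "Row_Step = Const rFound 0 ;; Const rGen 0 ;; For rL rCols Gen_Step ;;
    Store aPivot rI rFound ;; Add rRow rRow rCols"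

lemma written_Row_Step [simp]:
  "written_regs Row_Step =
    {1, rS, rT, rJ, rU, rV, rFac, rAcc, rPiv, rPivDot, rFound, rGen, rL, rRow}"
  "written_arrays Row_Step = {aGen, aAlive, aPivot}"
  by (auto simp: Row_Step_def)

abbreviation elim_state :: "nat \<Rightarrow> (nat \<Rightarrow> nat \<Rightarrow> 'f) \<Rightarrow> nat \<Rightarrow> (nat \<Rightarrow> nat \<Rightarrow> nat) \<Rightarrow> bool" where
  "elim_state n a i m \<equiv>
    elim_inv n a i (rd (m aGen) 0 n) {l. l < n \<and> m aAlive l \<noteq> 0} {l. l < i \<and> m aPivot l \<noteq> 0}"

lemma elim_state_step:
  assumes inv: "elim_state n a i m" and a: "a i = rd (m aIn) b n i"
    and scan: "scan_inv n (rd (m aGen) 0 n) (m aAlive) (\<lambda>l. dot n (a i) (rd (m aGen) 0 n l)) n r m'"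
    and P: "m' aPivot = (m aPivot)(i := r rFound)"
  shows "elim_state n a (Suc i) m'"
proof -
  let ?g = "rd (m aGen) 0 n" and ?L = "{l. l < n \<and> m aAlive l \<noteq> 0}" and ?U = "{l. l < i \<and> m aPivot l \<noteq> 0}"
  let ?d = "\<lambda>l. dot n (a i) (?g l)"
  have U: "{l. l < Suc i \<and> m' aPivot l \<noteq> 0} = (if r rFound = 0 then ?U else insert i ?U)"
    by (auto simp: P less_Suc_eq)
  from scan consider
      "r rFound = 0" "rd (m' aGen) 0 n = ?g" "m' aAlive = m aAlive" "\<forall>l<n. m aAlive l \<noteq> 0 \<longrightarrow> ?d l = 0"
    | p where "p < n" "m aAlive p \<noteq> 0" "?d p \<noteq> 0" "r rFound = 1" "m' aAlive = (m aAlive)(p := 0)"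
      "rd (m' aGen) 0 n = (\<lambda>l. if l < n \<and> l \<noteq> p \<and> m aAlive l \<noteq> 0 \<and> ?d l \<noteq> 0
         then \<lambda>j. ?d p * ?g l j + (- ?d l) * ?g p j else ?g l)"
    unfolding scan_inv_def by auto
  then show ?thesis
  proof cases
    case 1
    show ?thesis unfolding U using 1 elim_inv_skip[OF inv] by simp
  next
    case (2 p)
    have "{l. l < n \<and> m' aAlive l \<noteq> 0} = ?L - {p}" using 2(5) by auto
    \<comment> \<open>Orthogonal generators were kept as they are, which corresponds to the factors
      1 and 0; all others were scaled by the nonzero product of the pivot.\<close>
    moreover have "elim_inv n a (Suc i) (rd (m' aGen) 0 n) (?L - {p}) (insert i ?U)"
    proof (rule elim_inv_pivot[OF inv,
          where s = "\<lambda>l. if ?d l \<noteq> 0 then ?d p else 1" and t = "\<lambda>l. if ?d l \<noteq> 0 then - ?d l else 0"])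
      fix l assume l: "l \<in> ?L - {p}"
      show "rd (m' aGen) 0 n l = (\<lambda>j. (if ?d l \<noteq> 0 then ?d p else 1) * ?g l j +
          (if ?d l \<noteq> 0 then - ?d l else 0) * ?g p j)"
        using l 2(6) by auto
      have "dot n (a i) (\<lambda>j. ?d p * ?g l j + (- ?d l) * ?g p j) = 0"
        unfolding dot_linear[of n "a i" "\<lambda>j. ?d p * ?g l j"]
        using dot_linear[of n "a i" "\<lambda>_. 0" "?d p" "?g l"] by simp
      then show "dot n (a i) (rd (m' aGen) 0 n l) = 0" using l 2(6) by auto
    qed (use 2 in auto)
    ultimately show ?thesis unfolding U using 2(4) by simp
  qed
qed

lemma wp_Row_Step:
  assumes T: "tables (m aMul) (m aFma) (m aNonzero)" and v: "valid (m aIn)" "valid (m aGen)"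
    and r: "constants r" "r rCols = n" "r rRow = b + i * n" "r rI = i"
    and a: "a i = rd (m aIn) b n i" and inv: "elim_state n a i m"
  shows "wp Row_Step (\<lambda>t s. t \<le> n * (n * 32 + 24) + 7 \<and> valid (snd s aGen) \<and>
    fst s rRow = b + Suc i * n \<and> elim_state n a (Suc i) (snd s)) (r, m)"
proof -
  let ?I = "scan_inv n (rd (m aGen) 0 n) (m aAlive) (\<lambda>l. dot n (a i) (rd (m aGen) 0 n l))"
  show ?thesis unfolding Row_Step_def wp_Seq wp_basic
  proof (rule wp_For[where N = n and T = "n * 32 + 20" and I = ?I], goal_cases)
    case 1
    then show ?case using v by (simp add: scan_inv_def)
  next
    case (3 k r' m')
    then show ?case
      by (intro wp_Gen_Step[where b = b and i = i]) (use T v r a in \<open>auto simp: constants_def\<close>)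
  next
    case (6 t r' m')
    have reg: "r' rI = i" "r' rCols = n" "r' rRow = b + i * n" and P: "m' aPivot = m aPivot"
      using 6 r by auto
    let ?m = "m'(aPivot := (m' aPivot)(i := r' rFound))"
    have "?I n r' ?m" using 6(2) by (simp add: scan_inv_def)
    then have "elim_state n a (Suc i) ?m" by (rule elim_state_step[OF inv a]) (simp add: P)
    moreover have "valid (m' aGen)" using 6(2) by (simp add: scan_inv_def)
    ultimately show ?case using 6(1) reg by (simp add: algebra_simps)
  qed (use r in \<open>auto simp: scan_inv_def\<close>)
qed

definition Eliminate :: com where
  "Eliminate = Units ;; Copy rRow rEntries ;; For rI rRows Row_Step"

lemma written_Eliminate [simp]:
  "written_regs Eliminate =
    {1, rS, rT, rJ, rU, rV, rFac, rAcc, rPiv, rPivDot, rFound, rGen, rL, rRow, rI}"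
  "written_arrays Eliminate = {aGen, aAlive, aPivot}"
  by (auto simp: Eliminate_def)

lemma wp_Eliminate:
  assumes T: "tables (m aMul) (m aFma) (m aNonzero)" and v: "valid (m aIn)" "valid (m aGen)"
    and r: "constants r" "r rCols = n" "r rRows = M" "r rEntries = b"
    and a: "\<And>i. i < M \<Longrightarrow> a i = rd (m aIn) b n i"
    and post: "\<And>t r' m'. t \<le> n * (n * 6 + 11) + M * (n * (n * 32 + 24) + 11) + 8 \<Longrightarrow>
      valid (m' aGen) \<Longrightarrow> elim_state n a M m' \<Longrightarrow>
      (\<And>x. x \<notin> written_regs Eliminate \<Longrightarrow> r' x = r x) \<Longrightarrow>
      (\<And>a. a \<notin> {aGen, aAlive, aPivot} \<Longrightarrow> m' a = m a) \<Longrightarrow> Q t (r', m')"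
  shows "wp Eliminate Q (r, m)"
  unfolding Eliminate_def wp_Seq
proof (rule wp_Units[where n = n], goal_cases)
  case (4 t r1 G L)
  have reg: "constants r1" "r1 rCols = n" "r1 rRows = M" "r1 rEntries = b"
    using 4 r by (auto simp: constants_def)
  show ?case unfolding wp_basic
  proof (rule wp_For[where N = M and T = "n * (n * 32 + 24) + 7" and I = "\<lambda>k r' m'. valid (m' aGen) \<and>
      r' rRow = b + k * n \<and> elim_state n a k m'"], goal_cases)
    case 1
    have "{l. l < n \<and> L l \<noteq> 0} = {..<n}" using 4(4) by auto
    then show ?case using 4(2) reg elim_inv_init[OF 4(3), of n a] by simp
  next
    case (3 k r' m')
    then show ?case
      by (intro wp_Row_Step) (use T v reg a in \<open>auto simp: constants_def\<close>)
  next
    case (6 u r' m')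
    show ?case by (rule post) (use 6 4(1,5) in \<open>auto simp: algebra_simps\<close>)
  qed (use reg in auto)
qed (use v r in auto)

section \<open>Enumerating the words of a code\<close>

definition Add_Row :: "nat \<Rightarrow> com" where
  "Add_Row a = For rJ rCols (Load rU aWord rSrc ;; Add rV rGen rJ ;; Load rV a rV ;;
    Fma rU rU rA rV ;; Store aWord rDst rU ;; Add rSrc rSrc rOne ;; Add rDst rDst rOne)"

lemma written_Add_Row [simp]:
  "written_regs (Add_Row a) = {1, rS, rJ, rU, rV, rSrc, rDst}" "written_arrays (Add_Row a) = {aWord}"
  by (auto simp: Add_Row_def)

lemma wp_Add_Row:
  assumes T: "tables (m aMul) (m aFma) (m aNonzero)" and v: "valid (m a)" "valid (m aWord)"
    and r: "constants r" "r rCols = n" "r rGen = b + l * n" "r rSrc = i * n" "r rDst = d * n"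
      "r rA = code c"
    and ne: "i \<noteq> d" "a \<noteq> aWord"
    and post: "\<And>t r' M. t \<le> n * 15 + 3 \<Longrightarrow> valid M \<Longrightarrow>
      rd M 0 n = (rd (m aWord) 0 n)(d := \<lambda>j. rd (m aWord) 0 n i j + c * rd (m a) b n l j) \<Longrightarrow>
      r' rSrc = Suc i * n \<Longrightarrow> r' rDst = Suc d * n \<Longrightarrow>
      (\<And>x. x \<notin> {1, rS, rJ, rU, rV, rSrc, rDst} \<Longrightarrow> r' x = r x) \<Longrightarrow> Q t (r', m(aWord := M))"
  shows "wp (Add_Row a) Q (r, m)"
proof -
  let ?w = "rd (m aWord) 0 n" and ?g = "rd (m a) b n l"
  let ?h = "\<lambda>k. ?w(d := \<lambda>j. if j < k then ?w i j + c * ?g j else ?w d j)"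
  show ?thesis unfolding Add_Row_def
  proof (rule wp_For[where N = n and T = 11 and I = "\<lambda>k r' m'. valid (m' aWord) \<and>
      rd (m' aWord) 0 n = ?h k \<and> r' rSrc = i * n + k \<and> r' rDst = d * n + k"], goal_cases)
    case (3 k r' m')
    have reg: "r' rGen = b + l * n" "r' rOne = 1" "r' rJ = k" "r' rA = code c"
      and ma: "m' a = m a"
      using 3 r ne by (auto simp: constants_def)
    have T': "tables (m' aMul) (m' aFma) (m' aNonzero)" using 3 T by auto
    have rdl: "m' aWord (i * n + k) = code (?w i k)" "m a (b + l * n + k) = code (?g k)"
      using rd_read0[of "m' aWord" k n i] rd_read[OF v(1), of k n b l] 3(1,2) ne by auto
    have "(?h k)(d := (?h k d)(k := ?w i k + c * ?g k)) = ?h (Suc k)"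
      by (auto simp: fun_eq_iff less_Suc_eq)
    then show ?case using 3(1,2)
      by (simp add: reg rdl ma T' valid_upd rd_upd0 wp_Fma[where u = "?w i k" and v = c and w = "?g k"])
  next
    case (6 t r' m')
    then have m': "m' = m(aWord := m' aWord)" by (auto simp: fun_eq_iff)
    have "?h n = ?w(d := \<lambda>j. ?w i j + c * ?g j)" by (auto simp: fun_eq_iff rd_outside)
    then have "Q t (r', m(aWord := m' aWord))" using 6 by (intro post) auto
    then show ?case using m' by simp
  qed (use v r in auto)
qed

definition Add_Multiple :: "nat \<Rightarrow> com" where
  "Add_Multiple a = Const rSrc 0 ;; For rX rOld (Add_Row a) ;; Add rWords rWords rOld"

lemma written_Add_Multiple [simp]:
  "written_regs (Add_Multiple a) = {1, rS, rJ, rU, rV, rSrc, rDst, rX, rWords}"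
  "written_arrays (Add_Multiple a) = {aWord}"
  by (auto simp: Add_Multiple_def)

lemma wp_Add_Multiple:
  assumes T: "tables (m aMul) (m aFma) (m aNonzero)" and v: "valid (m a)" "valid (m aWord)"
    and r: "constants r" "r rCols = n" "r rGen = b + l * n" "r rDst = D * n" "r rWords = D"
      "r rOld = K" "r rA = code c"
    and ne: "K \<le> D" "a \<noteq> aWord"
    and post: "\<And>t r' M. t \<le> K * (n * 15 + 7) + 5 \<Longrightarrow> valid M \<Longrightarrow>
      rd M 0 n = (\<lambda>i. if D \<le> i \<and> i < D + K
        then \<lambda>j. rd (m aWord) 0 n (i - D) j + c * rd (m a) b n l j else rd (m aWord) 0 n i) \<Longrightarrow>
      r' rDst = (D + K) * n \<Longrightarrow> r' rWords = D + K \<Longrightarrow>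
      (\<And>x. x \<notin> {1, rS, rJ, rU, rV, rSrc, rDst, rX, rWords} \<Longrightarrow> r' x = r x) \<Longrightarrow>
      Q t (r', m(aWord := M))"
  shows "wp (Add_Multiple a) Q (r, m)"
proof -
  let ?w = "rd (m aWord) 0 n" and ?g = "rd (m a) b n l"
  let ?h = "\<lambda>k i. if D \<le> i \<and> i < D + k then \<lambda>j. ?w (i - D) j + c * ?g j else ?w i"
  show ?thesis unfolding Add_Multiple_def wp_Seq wp_basic
  proof (rule wp_For[where N = K and T = "n * 15 + 3" and I = "\<lambda>k r' m'. valid (m' aWord) \<and>
      rd (m' aWord) 0 n = ?h k \<and> r' rSrc = k * n \<and> r' rDst = (D + k) * n"], goal_cases)
    case (3 k r' m')
    have ma: "m' a = m a" using 3 ne by auto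
    show ?case
    proof (rule wp_Add_Row[where n = n and b = b and l = l and i = k and d = "D + k" and c = c], goal_cases)
      case (12 t r2 M)
      have "(?h k)(D + k := \<lambda>j. ?h k k j + c * ?g j) = ?h (Suc k)"
        using 3(1) ne by (auto simp: fun_eq_iff)
      then show ?case using 12 3(2) by (simp add: ma)
    qed (use 3 T v r ne ma in \<open>auto simp: constants_def\<close>)
  next
    case (6 t r' m')
    then have m': "m' = m(aWord := m' aWord)" by (auto simp: fun_eq_iff)
    have reg: "r' rWords = D" "r' rOld = K" using 6 r by auto
    have "Q (1 + (t + 1)) (r'(rWords := D + K), m(aWord := m' aWord))"
      by (rule post) (use 6 in \<open>auto simp: algebra_simps\<close>)
    then show ?case using m' reg by simp
  qed (use v r in \<open>auto simp: fun_eq_iff\<close>)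
qed

text \<open>The old list already provides the multiple 0. Each nonzero scalar appends one shifted
  copy of it, so the zero word keeps index 0.\<close>

definition Adjoin :: "nat \<Rightarrow> com" where
  "Adjoin a = Copy rOld rWords ;;
    For rA rField (Load rS aNonzero rA ;; If_Nonzero rS (Add_Multiple a) Skip)"

lemma written_Adjoin [simp]:
  "written_regs (Adjoin a) = {1, rS, rJ, rU, rV, rSrc, rDst, rX, rWords, rOld, rA}"
  "written_arrays (Adjoin a) = {aWord}"
  by (auto simp: Adjoin_def)

lemma wp_Adjoin:
  assumes T: "tables (m aMul) (m aFma) (m aNonzero)" and v: "valid (m a)" "valid (m aWord)"
    and r: "constants r" "r rCols = n" "r rGen = b + l * n" "r rDst = K * n" "r rWords = K"
    and K: "0 < K" and ne: "a \<noteq> aWord"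
    and post: "\<And>t r' M. t \<le> q * (K * (n * 15 + 7) + 11) + 4 \<Longrightarrow> valid M \<Longrightarrow>
      rd M 0 n ` {..<q * K} = adjoin (rd (m aWord) 0 n ` {..<K}) (rd (m a) b n l) \<Longrightarrow>
      rd M 0 n 0 = rd (m aWord) 0 n 0 \<Longrightarrow>
      r' rDst = q * K * n \<Longrightarrow> r' rWords = q * K \<Longrightarrow>
      (\<And>x. x \<notin> written_regs (Adjoin a) \<Longrightarrow> r' x = r x) \<Longrightarrow> Q t (r', m(aWord := M))"
  shows "wp (Adjoin a) Q (r, m)"
proof -
  let ?w = "rd (m aWord) 0 n" and ?g = "rd (m a) b n l"
  \<comment> \<open>The scalars treated after \<open>k\<close> codes. The scalar 0 counts from the
    start although its code may be any number below \<open>q\<close>, so the list length is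
    expressed through \<open>card\<close> and not through \<open>k\<close>.\<close>
  let ?A = "\<lambda>k. insert 0 (decode ` {..<k})" let ?D = "\<lambda>k. card (?A k) * K"
  define J where "J k r' m' \<longleftrightarrow> valid (m' aWord) \<and> (\<forall>i<K. rd (m' aWord) 0 n i = ?w i) \<and>
      rd (m' aWord) 0 n ` {..<?D k} = (\<lambda>(x, c) j. x j + c * ?g j) ` (?w ` {..<K} \<times> ?A k) \<and>
      r' rWords = ?D k \<and> r' rDst = ?D k * n"
    for k and r' :: "nat \<Rightarrow> nat" and m' :: "nat \<Rightarrow> nat \<Rightarrow> nat"
  show ?thesis unfolding Adjoin_def wp_Seq wp_basic
  proof (rule wp_For[where N = q and T = "K * (n * 15 + 7) + 7" and I = J], goal_cases)
    case 1
    have "?w ` {..<K} = (\<lambda>(x, c) j. x j + c * ?g j) ` (?w ` {..<K} \<times> {0})"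
      by (auto simp: image_iff)
    then show ?case using v r by (simp add: J_def)
  next
    case (3 k r' m')
    have J: "valid (m' aWord)" "\<forall>i<K. rd (m' aWord) 0 n i = ?w i"
      "rd (m' aWord) 0 n ` {..<?D k} = (\<lambda>(x, c) j. x j + c * ?g j) ` (?w ` {..<K} \<times> ?A k)"
      "r' rWords = ?D k" "r' rDst = ?D k * n"
      using 3(2) unfolding J_def by - (elim conjE, assumption)+
    have ma: "m' a = m a" using 3 ne by auto
    have T': "tables (m' aMul) (m' aFma) (m' aNonzero)" using 3 T by auto
    have nz: "m' aNonzero k = (if decode k = 0 then 0 else 1)"
      using T' 3(1) code_decode[of k] unfolding tables_def by metis
    have Ak: "?A (Suc k) = insert (decode k) (?A k)" by (auto simp: lessThan_Suc)
    show ?case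
    proof (cases "decode k = 0")
      case True
      then have "?A (Suc k) = ?A k" using Ak by auto
      then have "J (Suc k) (r'(rS := 0)) m'" using J unfolding J_def by simp
      then show ?thesis using 3(3) True nz by simp
    next
      case False
      let ?w' = "rd (m' aWord) 0 n"
      have "decode k \<notin> decode ` {..<k}"
      proof
        assume "decode k \<in> decode ` {..<k}"
        then obtain i where "i < k" "decode k = decode i" by auto
        then show False using 3(1) code_decode[of k] code_decode[of i] by simp
      qed
      then have cA: "card (?A (Suc k)) = Suc (card (?A k))"
        unfolding Ak using False by (subst card_insert_disjoint) auto
      have KD: "K \<le> ?D k" by (simp add: card_gt_0_iff Suc_leI)
      have "wp (Add_Multiple a) (\<lambda>t s. t \<le> K * (n * 15 + 7) + 5 \<and> valid (snd s aWord) \<and>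
          rd (snd s aWord) 0 n = (\<lambda>i. if ?D k \<le> i \<and> i < ?D k + K
            then \<lambda>j. ?w' (i - ?D k) j + decode k * ?g j else ?w' i) \<and>
          fst s rDst = (?D k + K) * n \<and> fst s rWords = ?D k + K) (r'(rS := 1), m')"
        by (rule wp_Add_Multiple[where n = n and b = b and l = l and K = K and D = "?D k" and c = "decode k"])
          (use 3(3,4) code_decode[OF 3(1)] J T' v r ne ma KD in \<open>auto simp: constants_def\<close>)
      then show ?thesis using 3(3)
      proof (simp add: nz False, elim wp_mono, goal_cases)
        case (1 t s)
        let ?h = "rd (snd s aWord) 0 n"
        have h: "?h = (\<lambda>i. if ?D k \<le> i \<and> i < ?D k + K
            then \<lambda>j. ?w' (i - ?D k) j + decode k * ?g j else ?w' i)" using 1 by blast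
        have w': "?w' i = ?w i" if "i < K" for i using J(2) that by blast
        have split: "{..<?D (Suc k)} = {..<?D k} \<union> (\<lambda>i. ?D k + i) ` {..<K}"
        proof -
          have "(\<lambda>i. ?D k + i) ` {..<K} = {?D k..<?D k + K}"
            by (simp add: lessThan_atLeast0 image_add_atLeastLessThan add.commute)
          then show ?thesis unfolding cA by auto
        qed
        have "?h ` {..<?D (Suc k)} = ?w' ` {..<?D k} \<union> (\<lambda>i j. ?w i j + decode k * ?g j) ` {..<K}"
          unfolding split image_Un image_image by (intro arg_cong2[of _ _ _ _ "(\<union>)"] image_cong) (auto simp: h w')
        also have "?w' ` {..<?D k} = (\<lambda>(x, c) j. x j + c * ?g j) ` (?w ` {..<K} \<times> ?A k)"
          by (rule J(3))
        also have "\<dots> \<union> (\<lambda>i j. ?w i j + decode k * ?g j) ` {..<K} =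
            (\<lambda>(x, c) j. x j + c * ?g j) ` (?w ` {..<K} \<times> ?A (Suc k))"
          unfolding Ak by (auto simp: image_iff)
        finally have img: "?h ` {..<?D (Suc k)} =
          (\<lambda>(x, c) j. x j + c * ?g j) ` (?w ` {..<K} \<times> ?A (Suc k))" .
        have "\<forall>i<K. ?h i = ?w i"
        proof (intro allI impI)
          fix i assume i: "i < K"
          then have "\<not> ?D k \<le> i" using KD by linarith
          then have "?h i = ?w' i" unfolding h by (simp only: if_False simp_thms)
          then show "?h i = ?w i" using w'[OF i] by (rule trans)
        qed
        moreover have "?D k + K = ?D (Suc k)" unfolding cA by simp
        ultimately have "J (Suc k) (fst s) (snd s)"
          using 1 img unfolding J_def by (intro conjI) simp_all
        then show ?case using 1 by simp
      qed
    qed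
  next
    case (6 t r' m')
    then have m': "m' = m(aWord := m' aWord)" by (auto simp: fun_eq_iff)
    have "decode ` {..<q} = UNIV"
    proof -
      have "x \<in> decode ` {..<q}" for x by (rule image_eqI[of _ _ "code x"]) auto
      then show ?thesis by blast
    qed
    then have A: "?A q = UNIV" by simp
    have J: "valid (m' aWord)" "\<forall>i<K. rd (m' aWord) 0 n i = ?w i"
      "rd (m' aWord) 0 n ` {..<q * K} = adjoin (?w ` {..<K}) ?g"
      "r' rWords = q * K" "r' rDst = q * K * n"
      using 6(2) unfolding J_def A q_eq[symmetric] adjoin_def by - (elim conjE, assumption)+
    have "Q (1 + t) (r', m(aWord := m' aWord))"
    proof (rule post)
      show "1 + t \<le> q * (K * (n * 15 + 7) + 11) + 4" using 6(1) by (simp add: algebra_simps)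
      show "rd (m' aWord) 0 n 0 = ?w 0" using J(2) K by simp
      show "r' x = r x" if "x \<notin> written_regs (Adjoin a)" for x using 6(3)[of x] that by simp
    qed (fact J)+
    then show ?case using m' by simp
  qed (use v r in \<open>auto simp: constants_def J_def\<close>)
qed


text \<open>The list starts as the span of the empty set, a single zero word. The arrays
  \<open>a\<close> and \<open>f\<close> hold generators and selection flags, so the same code serves
  live generators and pivot rows.\<close>

definition Enumerate :: "nat \<Rightarrow> nat \<Rightarrow> com" where
  "Enumerate a f = For rJ rCols (Store aWord rJ rZero) ;; Const rWords 1 ;; Copy rDst rCols ;;
    For rL rNumGens (Load rS f rL ;; If_Nonzero rS (Adjoin a) Skip ;; Add rGen rGen rCols)"

lemma written_Enumerate [simp]:
  "written_regs (Enumerate a f) =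
    {1, rS, rJ, rU, rV, rSrc, rDst, rX, rWords, rOld, rA, rL, rGen}"
  "written_arrays (Enumerate a f) = {aWord}"
  by (auto simp: Enumerate_def)

lemma wp_Enumerate:
  assumes T: "tables (m aMul) (m aFma) (m aNonzero)" and v: "valid (m a)" "valid (m aWord)"
    and r: "constants r" "r rCols = n" "r rGen = b" "r rNumGens = K"
    and ne: "a \<noteq> aWord" "f \<noteq> aWord"
    and L: "L = {l. l < K \<and> m f l \<noteq> 0}" and W: "W = q ^ card L"
    and post: "\<And>t r' M. t \<le> n * 5 + K * (q * (W * (n * 15 + 7) + 11) + 11) + 8 \<Longrightarrow> valid M \<Longrightarrow>
      rd M 0 n ` {..<W} = span_of (rd (m a) b n) L \<Longrightarrow> rd M 0 n 0 = (\<lambda>_. 0) \<Longrightarrow> r' rWords = W \<Longrightarrow>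
      (\<And>x. x \<notin> written_regs (Enumerate a f) \<Longrightarrow> r' x = r x) \<Longrightarrow> Q t (r', m(aWord := M))"
  shows "wp (Enumerate a f) Q (r, m)"
  unfolding Enumerate_def wp_Seq
proof (rule wp_For[where N = n and T = 1 and I = "\<lambda>k r' m'. valid (m' aWord) \<and>
    (\<forall>j<k. m' aWord j = code 0)"], goal_cases)
  case (3 k r' m')
  then have "r' rZero = code 0" using r by (auto simp: constants_def)
  then show ?case using 3 by (auto simp: valid_upd less_Suc_eq)
next
  case (6 t0 r0 m0)
  let ?g = "rd (m a) b n" and ?L = "\<lambda>k. {l. l < k \<and> m f l \<noteq> 0}"
  have reg0: "constants r0" "r0 rCols = n" "r0 rGen = b" "r0 rNumGens = K"
    and m0: "\<And>c. c \<noteq> aWord \<Longrightarrow> m0 c = m c"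
    using 6 r by (auto simp: constants_def)
  have fL: "finite (?L k)" for k by simp
  have LS: "?L (Suc k) = (if m f k = 0 then ?L k else insert k (?L k))" for k
    by (auto simp: less_Suc_eq)
  \<comment> \<open>Intermediate lists are no longer than the final one, so one time bound fits all
    rounds.\<close>
  have le: "q ^ card (?L k) \<le> W" if "k \<le> K" for k
  proof -
    have "card (?L k) \<le> card L" unfolding L using that by (intro card_mono) auto
    then show ?thesis unfolding W using q_ge_2 by (intro power_increasing) auto
  qed
  define J where "J k r' m' \<longleftrightarrow> valid (m' aWord) \<and> r' rGen = b + k * n \<and>
      rd (m' aWord) 0 n ` {..<q ^ card (?L k)} = span_of ?g (?L k) \<and> rd (m' aWord) 0 n 0 = (\<lambda>_. 0) \<and>
      r' rWords = q ^ card (?L k) \<and> r' rDst = q ^ card (?L k) * n"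
    for k and r' :: "nat \<Rightarrow> nat" and m' :: "nat \<Rightarrow> nat \<Rightarrow> nat"
  show ?case unfolding wp_basic wp_Seq
  proof (rule wp_For[where N = K and T = "q * (W * (n * 15 + 7) + 11) + 7" and I = J], goal_cases)
    case 1
    have "m0 aWord j = code 0" if "j < n" for j using 6(2) that by blast
    then have "rd (m0 aWord) 0 n 0 = (\<lambda>_. 0)" by (auto simp: rd_def)
    moreover have "{..<Suc 0} = {0 :: nat}" by auto
    ultimately show ?case using 6(2) reg0 by (simp add: J_def)
  next
    case (3 k r' m')
    have m': "m' c = m c" if "c \<noteq> aWord" for c using 3(5) that m0 by simp
    have reg: "constants r'" "r' rCols = n" "r' rL = k" using 3(3,4) reg0 by (auto simp: constants_def)
    have J: "valid (m' aWord)" "r' rGen = b + k * n"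
      "rd (m' aWord) 0 n ` {..<q ^ card (?L k)} = span_of ?g (?L k)" "rd (m' aWord) 0 n 0 = (\<lambda>_. 0)"
      "r' rWords = q ^ card (?L k)" "r' rDst = q ^ card (?L k) * n"
      using 3(2) unfolding J_def by - (elim conjE, assumption)+
    have mf: "m' f k = m f k" using m' ne by simp
    show ?case
    proof (cases "m f k = 0")
      case True
      then have "J (Suc k) (r'(rS := 0, rGen := b + k * n + n)) m'"
        using J unfolding J_def LS by simp
      then show ?thesis using True by (simp add: reg J(2) mf)
    next
      case False
      have adj: "wp (Adjoin a) (\<lambda>t s. \<exists>r2 M. s = (r2, m'(aWord := M)) \<and>
          t \<le> q * (W * (n * 15 + 7) + 11) + 4 \<and> valid M \<and>
          rd M 0 n ` {..<q * q ^ card (?L k)} = adjoin (span_of ?g (?L k)) (?g k) \<and>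
          rd M 0 n 0 = (\<lambda>_. 0) \<and> r2 rDst = q * q ^ card (?L k) * n \<and> r2 rWords = q * q ^ card (?L k) \<and>
          r2 rCols = n \<and> r2 rGen = b + k * n) (r'(rS := m f k), m')"
      proof (rule wp_Adjoin[where n = n and b = b and l = k and K = "q ^ card (?L k)"], goal_cases)
        case (11 t r2 M)
        have "q * (q ^ card (?L k) * (n * 15 + 7) + 11) + 4 \<le> q * (W * (n * 15 + 7) + 11) + 4"
          using le[of k] 3(1) by simp
        then have "t \<le> q * (W * (n * 15 + 7) + 11) + 4" using 11(1) by (rule order_trans[rotated])
        moreover have "r2 rCols = n" "r2 rGen = b + k * n" using 11(7) reg J by simp_all
        moreover have "rd M 0 n ` {..<q * q ^ card (?L k)} = adjoin (span_of ?g (?L k)) (?g k)"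
          using 11(3) unfolding J(3) m'[OF ne(1)] .
        moreover have "rd M 0 n 0 = (\<lambda>_. 0)" using 11(4) unfolding J(4) .
        ultimately show ?case using 11(2,5,6) by (intro exI[of _ r2] exI[of _ M] conjI refl)
      qed (use T v reg J(1,2,5,6) m' ne in \<open>auto simp: constants_def\<close>)
      show ?thesis
      proof (simp add: reg mf False, rule wp_mono[OF adj], goal_cases)
        case (1 t s)
        then obtain r2 M where s: "s = (r2, m'(aWord := M))" and t: "t \<le> q * (W * (n * 15 + 7) + 11) + 4"
          and M: "valid M" "rd M 0 n ` {..<q * q ^ card (?L k)} = adjoin (span_of ?g (?L k)) (?g k)"
            "rd M 0 n 0 = (\<lambda>_. 0)" "r2 rDst = q * q ^ card (?L k) * n" "r2 rWords = q * q ^ card (?L k)"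
            "r2 rCols = n" "r2 rGen = b + k * n"
          by blast
        have "J (Suc k) (r2(rGen := b + k * n + n)) (m'(aWord := M))"
          using M False unfolding J_def LS by (simp add: span_of_insert)
        then show ?case using t M by (simp add: s)
      qed
    qed
  next
    case (6 t r' m')
    have "m' = m(aWord := m' aWord)" using 6(4) m0 by (auto simp: fun_eq_iff)
    moreover have "Q (t0 + (1 + (1 + t))) (r', m(aWord := m' aWord))"
    proof (rule post)
      show "t0 + (1 + (1 + t)) \<le> n * 5 + K * (q * (W * (n * 15 + 7) + 11) + 11) + 8"
        using \<open>t0 \<le> n * (1 + 4) + 3\<close> 6(1) by (simp add: algebra_simps)
      show "r' x = r x" if "x \<notin> written_regs (Enumerate a f)" for x
        using 6(3)[of x] \<open>\<And>x. x \<notin> insert rJ (insert 1 (written_regs (Store aWord rJ rZero))) \<Longrightarrow> r0 x = r x\<close>[of x]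
          that by simp
    qed (use 6(2) in \<open>simp_all add: J_def L W\<close>)
    ultimately show ?case by simp
  qed (use reg0 in \<open>auto simp: J_def\<close>)
qed (use v r in auto)

section \<open>The counting program\<close>

text \<open>The lowest bit of \<open>y\<close> is obtained as \<open>y - y div 2 - y div 2\<close>.
  \<open>rBit\<close> runs through the powers of two by doubling, and \<open>rPos\<close> through
  one column of the word list.\<close>

definition Bit_Step :: com where
  "Bit_Step = Half rHalf rMask ;; Sub rOdd rMask rHalf ;; Sub rOdd rOdd rHalf ;; Copy rMask rHalf ;;
    If_Nonzero rOdd
      (Load rS aWord rPos ;; Load rS aNonzero rS ;; If_Nonzero rS Skip (Add rTarget rTarget rBit)) Skip ;;
    Add rBit rBit rBit ;; Add rPos rPos rCols"

text \<open>Because \<open>shrink\<close> never increases a mask, the truncated difference of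
  \<open>rX\<close> and \<open>rTarget\<close> is nonzero exactly if the mask changes.\<close>

definition Mask_Step :: com where
  "Mask_Step = Copy rMask rX ;; Const rTarget 0 ;; Copy rBit rOne ;; Copy rPos rJ ;;
    For rL rWords Bit_Step ;; Sub rS rX rTarget ;;
    If_Nonzero rS (Load rS aCount rX ;; Load rT aCount rTarget ;; Add rT rT rS ;; Store aCount rTarget rT) Skip"

text \<open>The table starts with a single 1 at the full mask \<open>2 ^ Q - 1\<close>, and the
  answer is read at mask 1, for which \<open>rOne\<close> serves as the address.\<close>

definition Count :: com where
  "Count = Const rMasks 1 ;; For rL rWords (Add rMasks rMasks rMasks) ;;
    Sub rS rMasks rOne ;; Store aCount rS rOne ;;
    For rJ rCols (For rX rMasks Mask_Step) ;; Load 0 aCount rOne"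

lemma written_Bit_Step [simp]:
  "written_regs Bit_Step = {rS, rHalf, rOdd, rMask, rTarget, rBit, rPos}" "written_arrays Bit_Step = {}"
  by (auto simp: Bit_Step_def)

lemma written_Mask_Step [simp]:
  "written_regs Mask_Step = {1, rS, rT, rL, rHalf, rOdd, rMask, rTarget, rBit, rPos}"
  "written_arrays Mask_Step = {aCount}"
  by (auto simp: Mask_Step_def)

lemma shrink_Suc:
  "set_encode {i \<in> set_decode X. i < Suc k \<and> w i j = 0} =
    set_encode {i \<in> set_decode X. i < k \<and> w i j = 0} +
    (if odd (X div 2 ^ k) \<and> w k j = 0 then 2 ^ k else 0)"
proof -
  have "{i \<in> set_decode X. i < Suc k \<and> w i j = 0} =
      (if odd (X div 2 ^ k) \<and> w k j = 0 then insert k else id) {i \<in> set_decode X. i < k \<and> w i j = 0}"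
    by (auto simp: less_Suc_eq set_decode_def)
  then show ?thesis by (simp add: set_encode_insert)
qed

lemma wp_Mask_Step:
  assumes T: "tables (m aMul) (m aFma) (m aNonzero)" and v: "valid (m aWord)"
    and r: "constants r" "r rCols = n" "r rWords = W" "r rJ = j" "r rX = X" and j: "j < n"
    and w: "w = rd (m aWord) 0 n"
    and post: "\<And>t r'. t \<le> W * 16 + 14 \<Longrightarrow>
      (\<And>x. x \<notin> written_regs Mask_Step \<Longrightarrow> r' x = r x) \<Longrightarrow>
      Q t (r', m(aCount := (if shrink w W j X = X then m aCount else
        (m aCount)(shrink w W j X := m aCount (shrink w W j X) + m aCount X))))"
  shows "wp Mask_Step Q (r, m)"
  unfolding Mask_Step_def wp_Seq wp_basic
proof (rule wp_For[where N = W and T = 12 and I = "\<lambda>k r' m'. m' = m \<and> r' rMask = X div 2 ^ k \<and>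
    r' rBit = 2 ^ k \<and> r' rPos = j + k * n \<and>
    r' rTarget = set_encode {i \<in> set_decode X. i < k \<and> w i j = 0}"], goal_cases)
  case (3 k r' m')
  have reg: "r' rCols = n" "m' = m" "r' rMask = X div 2 ^ k" "r' rBit = 2 ^ k" "r' rPos = j + k * n"
    "r' rTarget = set_encode {i \<in> set_decode X. i < k \<and> w i j = 0}"
    using 3 r by auto
  have "m aWord (j + k * n) = code (w k j)"
    using rd_read0[OF v j, of k] by (simp add: w add.commute)
  then have nz: "m aNonzero (m aWord (j + k * n)) = (if w k j = 0 then 0 else 1)"
    using T by (simp add: tables_def)
  have half: "y \<le> y div 2 + y div 2 \<longleftrightarrow> even y" for y :: nat
    by presburger
  have div: "X div (2 * 2 ^ k) = X div 2 ^ k div 2"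
    by (simp only: mult.commute[of 2] div_mult2_eq)
  show ?case
    unfolding shrink_Suc
    by (simp add: Bit_Step_def reg nz half div)
next
  case (6 t r' m')
  have reg: "m' = m" "r' rX = X" "r' rTarget = shrink w W j X" using 6 r by (auto simp: shrink_def)
  have fr: "r' x = r x" if "x \<notin> written_regs Mask_Step" for x using 6(3)[of x] that by simp
  have le: "shrink w W j X \<le> X" by (rule shrink_le)
  show ?case
  proof (cases "shrink w W j X = X")
    case True
    have "Q (Suc (Suc (Suc (Suc (Suc (Suc (Suc t))))))) (r'(rS := 0), m)"
      using post[of "Suc (Suc (Suc (Suc (Suc (Suc (Suc t))))))" "r'(rS := 0)"] True 6(1) fr by simp
    then show ?thesis using True reg by simp
  next
    case False
    then have "\<not> X \<le> shrink w W j X" using le by simp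
    let ?t = "Suc (Suc (Suc (Suc (Suc (Suc (Suc (Suc (Suc (Suc t)))))))))"
    let ?r = "r'(rS := m aCount X, rT := m aCount (shrink w W j X) + m aCount X)"
    have "Q ?t (?r, m(aCount := (m aCount)(shrink w W j X := m aCount (shrink w W j X) + m aCount X)))"
      using post[of ?t ?r] False 6(1) fr by simp
    then show ?thesis using \<open>\<not> X \<le> shrink w W j X\<close> reg by simp
  qed
qed (use r in \<open>auto simp: constants_def set_encode_def\<close>)

lemma wp_Count:
  assumes T: "tables (m aMul) (m aFma) (m aNonzero)" and v: "valid (m aWord)"
    and r: "constants r" "r rCols = n" "r rWords = W" and m: "m aCount = (\<lambda>_. 0)"
    and w: "w = rd (m aWord) 0 n" and W: "0 < W"
    and code: "linear_code (w ` {..<W})" and inj: "inj_on w {..<W}" and w0: "w 0 = (\<lambda>_. 0)"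
    and post: "\<And>t r' m'. t \<le> W * 5 + n * (2 ^ W * (W * 16 + 18) + 7) + 10 \<Longrightarrow>
      r' 0 = card (info_sets n (w ` {..<W})) \<Longrightarrow> Q t (r', m')"
  shows "wp Count Q (r, m)"
  unfolding Count_def wp_Seq wp_basic
proof (rule wp_For[where N = W and T = 1 and I = "\<lambda>k r' m'. m' = m \<and> r' rMasks = 2 ^ k"], goal_cases)
  case (6 t1 r1 m1)
  have m1: "m1 = m" and reg1: "r1 rMasks = 2 ^ W" "r1 rCols = n" "r1 rWords = W" "r1 rOne = 1" "constants r1"
    using 6 r by (auto simp: constants_def)
  show ?case unfolding m1 wp_basic
  proof (rule wp_For[where N = n and T = "2 ^ W * (W * 16 + 18) + 3" and
        I = "\<lambda>k r' m'. \<forall>Z<2 ^ W. m' aCount Z = dp w W k Z"], goal_cases)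
    case 1
    then show ?case using reg1 m by (simp add: dp_0)
  next
    case (3 k r2 m2)
    have reg2: "r2 rMasks = 2 ^ W" "r2 rCols = n" "r2 rWords = W" "constants r2" "r2 rJ = k"
      and m2: "\<And>c. c \<noteq> aCount \<Longrightarrow> m2 c = m c"
      using 3(3-) reg1 by (auto simp: constants_def)
    show ?case
    proof (rule wp_For[where N = "2 ^ W" and T = "W * 16 + 14" and
          I = "\<lambda>X r' m'. \<forall>Z<2 ^ W. m' aCount Z = dp_partial w W k X Z"], goal_cases)
      case 1
      then show ?case using 3(2) by (simp add: dp_partial_0)
    next
      case (3 X r3 m3)
      have reg3: "r3 rCols = n" "r3 rWords = W" "constants r3" "r3 rJ = k" "r3 rX = X"
        and m3: "\<And>c. c \<noteq> aCount \<Longrightarrow> m3 c = m c"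
        using 3(3-) reg2 m2 by (auto simp: constants_def)
      show ?case
      proof (rule wp_Mask_Step[where n = n and W = W and j = k and X = X and w = w], goal_cases)
        case (10 t r')
        have "shrink w W k X < 2 ^ W" using shrink_le[of w W k X] 3(1) by linarith
        then show ?case using 10(1) 3(1,2) by (auto simp: dp_partial_Suc dp_partial_same)
      qed (use T v w \<open>k < n\<close> reg3 m3 in \<open>simp_all add: m3\<close>)
    next
      case (6 t r' m')
      then show ?case using dp_Suc[OF code inj] by (simp add: algebra_simps)
    qed (use reg2 in auto)
  next
    case (6 t r' m')
    have "r' rOne = 1" using 6(3)[of rOne] reg1 by simp
    moreover have "(1 :: nat) < 2 ^ W" by (rule one_less_power) (use W in simp_all)
    ultimately have "m' aCount (r' rOne) = card (info_sets n (w ` {..<W}))"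
      using 6(2) dp_final[OF inj w0 W, of n] by simp
    then show ?case unfolding wp_basic
      by (intro post) (use 6(1) \<open>t1 \<le> W * (1 + 4) + 3\<close> in \<open>auto simp: algebra_simps\<close>)
  qed (use reg1 in auto)
qed (use r in auto)

end

section \<open>The two programs\<close>

lemma nth_concat_rows:
  assumes "i < M" "j < n"
  shows "concat (map (\<lambda>i. map (f i) [0..<n]) [0..<M]) ! (i * n + j) = f i j"
  using assms
proof (induction M)
  case (Suc M)
  let ?c = "concat (map (\<lambda>i. map (f i) [0..<n]) [0..<M])"
  have len: "length ?c = M * n" by (simp add: length_concat comp_def sum_list_triv)
  show ?case
  proof (cases "i = M")
    case True
    then show ?thesis using Suc.prems len by (simp add: nth_append)
  next
    case False
    then have i: "i < M" using Suc.prems by simp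
    have "i * n + j < Suc i * n" using Suc.prems by simp
    also have "\<dots> \<le> M * n" using i by (intro mult_le_mono1) simp
    finally show ?thesis using Suc.IH[OF i Suc.prems(2)] len by (simp add: nth_append)
  qed
qed simp

text \<open>Only additions are available: the inner loop multiplies by \<open>q\<close>, and each of
  the \<open>q ^ k\<close> rounds of the last loop doubles three times, whence the factor 3 in the
  exponent.\<close>

lemma computable_double_exp: "computable (\<lambda>k. C * 2 ^ (3 * q ^ k))"
proof -
  \<comment> \<open>Register 5 is still 0, so the first instruction reads the argument
    \<open>k\<close> from address 0.\<close>
  define p where "p = Load 2 0 5 ;; Const 3 1 ;; Const 4 q ;;
    For 6 2 (Const 7 0 ;; For 8 4 (Add 7 7 3) ;; Copy 3 7) ;;
    Const 0 C ;; For 6 3 (Add 0 0 0 ;; Add 0 0 0 ;; Add 0 0 0)"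
  have "wp p (\<lambda>t s. fst s 0 = C * 2 ^ (3 * q ^ k)) (initial_state [k])" for k
    unfolding p_def initial_state_def wp_Seq wp_basic
  proof (rule wp_For[where N = k and T = "q * 5 + 5" and I = "\<lambda>i r m. r 3 = q ^ i"], goal_cases)
    case (3 i r m)
    have r: "r 4 = q" using 3(4)[of 4] by simp
    show ?case unfolding wp_Seq wp_basic
    proof (rule wp_For[where N = q and T = 1 and I = "\<lambda>j r m. r 7 = j * q ^ i"], goal_cases)
      case (3 j r' m')
      have "r' 3 = q ^ i" using 3(4)[of 3] \<open>r 3 = q ^ i\<close> by simp
      then show ?case using 3(2) by simp
    qed (use r in auto)
  next
    case (6 t r m)
    show ?case unfolding wp_basic
      by (rule wp_For[where N = "q ^ k" and T = 3 and I = "\<lambda>i r m. r 0 = C * 2 ^ (3 * i)"])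
        (use 6(2) in \<open>auto simp: power_add\<close>)
  qed auto
  then have "\<exists>t. computes_in_steps p [k] t (C * 2 ^ (3 * q ^ k))" for k
    unfolding computes_in_steps_def wp_def by blast
  then show ?thesis unfolding computable_def by blast
qed

context field_coding
begin

definition Prepare :: com where
  "Prepare = Setup ;; Parse ;; Eliminate"

text \<open>Register \<open>x\<close> holds the address of the first generator in array
  \<open>a\<close>, and register \<open>y\<close> their number before selection by the flags in
  \<open>f\<close>.\<close>

definition Solve :: "nat \<Rightarrow> nat \<Rightarrow> nat \<Rightarrow> nat \<Rightarrow> com" where
  "Solve x y a f = Copy rGen x ;; Copy rNumGens y ;; Enumerate a f ;; Count"

lemma wp_Prepare:
  assumes post: "\<And>t r m. t \<le> (3 * (q * q) + 3 * (q * (q * q)) + 3 * q + 8) +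
      (dim_row A * 3 + dim_col A * 4 + 6) +
      (dim_col A * (dim_col A * 6 + 11) + dim_row A * (dim_col A * (dim_col A * 32 + 24) + 11) + 8) \<Longrightarrow>
    tables (m aMul) (m aFma) (m aNonzero) \<Longrightarrow> constants r \<Longrightarrow>
    r rRows = dim_row A \<Longrightarrow> r rCols = dim_col A \<Longrightarrow> r rEntries = dim_row A + dim_col A + 2 \<Longrightarrow>
    r rPos = 0 \<Longrightarrow> valid (m aIn) \<Longrightarrow> valid (m aGen) \<Longrightarrow> m aWord = (\<lambda>_. 0) \<Longrightarrow> m aCount = (\<lambda>_. 0) \<Longrightarrow>
    (\<And>i. i < dim_row A \<Longrightarrow> rd (m aIn) (dim_row A + dim_col A + 2) (dim_col A) i = matrix_row A i) \<Longrightarrow>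
    elim_state (dim_col A) (matrix_row A) (dim_row A) m \<Longrightarrow> Q t (r, m)"
  shows "wp Prepare Q (initial_state (matrix_word code A))"
proof -
  let ?M = "dim_row A" and ?n = "dim_col A" and ?w = "matrix_word code A"
  let ?c = "concat (map (\<lambda>i. map (\<lambda>j. code (A $$ (i, j))) [0..<?n]) [0..<?M])"
  define h where "h i = (if i < length ?w then ?w ! i else 0)" for i
  have len: "length ?c = ?M * ?n" by (simp add: length_concat comp_def sum_list_triv)
  have w: "?w = replicate ?M 1 @ [0] @ replicate ?n 1 @ [0] @ ?c" by (simp add: matrix_word_def)
  have lenw: "length ?w = ?M + ?n + 2 + ?M * ?n" unfolding w using len by simp
  have h1: "h i = 1" if "i < ?M" for i using that unfolding h_def lenw unfolding w by (simp add: nth_append)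
  have h2: "h ?M = 0" unfolding h_def w by (simp add: nth_append)
  have h3: "h (?M + 1 + j) = 1" if "j < ?n" for j
    using that unfolding h_def lenw unfolding w by (simp add: nth_append)
  have h4: "h (?M + 1 + ?n) = 0" unfolding h_def w by (simp add: nth_append)
  have h5: "h (?M + ?n + 2 + (i * ?n + j)) = code (A $$ (i, j))" if "i < ?M" "j < ?n" for i j
  proof -
    have "i * ?n + j < Suc i * ?n" using that by simp
    also have "\<dots> \<le> ?M * ?n" using that by (intro mult_le_mono1) simp
    finally have "?M + ?n + 2 + (i * ?n + j) < length ?w" unfolding lenw by simp
    moreover have "?w ! (?M + ?n + 2 + (i * ?n + j)) = ?c ! (i * ?n + j)"
      unfolding w by (simp add: nth_append)
    ultimately show ?thesis using nth_concat_rows[OF that, of "\<lambda>i j. code (A $$ (i, j))"]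
      by (simp add: h_def)
  qed
  \<comment> \<open>The unary digits and terminators are also below \<open>q\<close>, so the entire
    input array satisfies \<open>valid\<close>.\<close>
  have sub: "set ?w \<subseteq> {..<q}" unfolding w using q_ge_2 by auto
  have "h i < q" for i using subsetD[OF sub nth_mem[of i ?w]] by (simp add: h_def)
  then have vh: "valid h" unfolding valid_def by blast
  have init: "initial_state ?w =
      ((\<lambda>x. if x = 0 then length ?w else 0), (\<lambda>_ _. 0)(aIn := h))"
    by (auto simp: initial_state_def fun_eq_iff h_def)
  show ?thesis unfolding Prepare_def wp_Seq init
  proof (rule wp_Setup, goal_cases)
    case (1 t1 r1 m1)
    have m1: "m1 aIn = h" "\<And>a. a \<notin> {aIn, aMul, aFma, aNonzero} \<Longrightarrow> m1 a = (\<lambda>_. 0)"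
      using 1(5) by auto
    have r1: "r1 rRows = 0" "r1 rCols = 0" "r1 rPos = 0" using 1(4) by simp_all
    show ?case
    proof (rule wp_Parse[where M = ?M and N = ?n], goal_cases)
      case (8 t2 r2)
      have reg: "constants r2" using 1(3) 8(5) by (auto simp: constants_def)
      have rd: "rd (m1 aIn) (?M + ?n + 2) ?n i = matrix_row A i" if "i < ?M" for i
        using h5[OF that] that by (auto simp: m1(1) fun_eq_iff rd_def matrix_row_def add.assoc)
      show ?case
      proof (rule wp_Eliminate[where n = ?n and M = ?M and b = "?M + ?n + 2" and a = "matrix_row A"],
          goal_cases)
        case (9 t3 r3 m3)
        show ?case
        proof (rule post)
          show "t1 + (t2 + t3) \<le> (3 * (q * q) + 3 * (q * (q * q)) + 3 * q + 8) + (?M * 3 + ?n * 4 + 6) +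
              (?n * (?n * 6 + 11) + ?M * (?n * (?n * 32 + 24) + 11) + 8)"
            using 1(1) 8(1) 9(1) by linarith
          show "constants r3" using reg 9(4) by (simp add: constants_def)
          show "tables (m3 aMul) (m3 aFma) (m3 aNonzero)" using 1(2) 9(5) by simp
          show "r3 rPos = 0" using 9(4) 8(5) r1 by simp
          show "valid (m3 aIn)" using 9(5) m1(1) vh by simp
          show "rd (m3 aIn) (?M + ?n + 2) ?n i = matrix_row A i" if "i < ?M" for i
            using rd[OF that] 9(5) by simp
        qed (use 9 8 m1 in auto)
      qed (use 1 8 reg m1 vh rd in \<open>auto simp: valid_def\<close>)
    qed (use 1(3) r1 m1(1) h1 h2 h3 h4 in \<open>auto simp: constants_def\<close>)
  qed
qed

lemma wp_Solve:
  assumes T: "tables (m aMul) (m aFma) (m aNonzero)" and v: "valid (m a)"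
    and r: "constants r" "r rCols = n" "r x = b" "r y = K" and y: "y \<noteq> rGen"
    and m: "m aWord = (\<lambda>_. 0)" "m aCount = (\<lambda>_. 0)"
    and ne: "a \<noteq> aWord" "f \<noteq> aWord"
    and L: "L = {l. l < K \<and> m f l \<noteq> 0}" and W: "W = q ^ card L"
    and card: "card (span_of (rd (m a) b n) L) = W"
    and post: "\<And>t r' m'. t \<le> n * 5 + K * (q * (W * (n * 15 + 7) + 11) + 11) + 8 +
        (W * 5 + n * (2 ^ W * (W * 16 + 18) + 7) + 10) + 2 \<Longrightarrow>
      r' 0 = card (info_sets n (span_of (rd (m a) b n) L)) \<Longrightarrow> Q t (r', m')"
  shows "wp (Solve x y a f) Q (r, m)"
  unfolding Solve_def wp_Seq wp_basic
proof (rule wp_Enumerate[where n = n and b = b and K = K and L = L and W = W], goal_cases)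
  case (12 t1 r1 M)
  let ?S = "span_of (rd (m a) b n) L"
  have reg: "constants r1" "r1 rCols = n" using 12(6) r by (simp_all add: constants_def)
  have fL: "finite L" unfolding L by simp
  have W0: "0 < W" unfolding W by simp
  \<comment> \<open>Here independence of the generators enters: \<open>W\<close> indices are mapped
    onto \<open>W\<close> words, so the list has no repetitions.\<close>
  have inj: "inj_on (rd M 0 n) {..<W}"
    by (rule eq_card_imp_inj_on) (simp_all add: 12(3) card)
  show ?case
  proof (rule wp_Count[where n = n and W = W and w = "rd M 0 n"], goal_cases)
    case goal12: (12 t r' m')
    show ?case by (rule post) (use goal12 12(1,3) in \<open>simp_all add: 12(3)\<close>)
  qed (use T 12(2,4,5) reg m W0 inj linear_code_span_of[OF fL] in \<open>simp_all add: 12(3)\<close>)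
qed (use T v r y m ne L W in \<open>auto simp: constants_def valid_def\<close>)

section \<open>Running time and parameterized tractability\<close>

text \<open>After expansion each monomial has degree at most three in the quantities bounded by
  \<open>B\<close>; factors 1 pad it to a triple product. The coefficients sum to
  \<open>c + 187 + 33 * q\<close>, rounded up in the statement.\<close>

lemma time_bound:
  fixes B :: nat
  assumes B: "1 \<le> B" "M \<le> B" "n \<le> B" "K \<le> B" "W \<le> B" "E \<le> B"
  shows "c + (M * 3 + n * 4 + 6) +
    (n * (n * 6 + 11) + M * (n * (n * 32 + 24) + 11) + 8) +
    (n * 5 + K * (q * (W * (n * 15 + 7) + 11) + 11) + 8 +
      (W * 5 + n * (E * (W * 16 + 18) + 7) + 10) + 2) \<le> (c + 200 + 40 * q) * B ^ 3"
proof -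
  have mon: "x * y * z \<le> B ^ 3" if "x \<le> B" "y \<le> B" "z \<le> B" for x y z
    unfolding power3_eq_cube by (intro mult_le_mono that)
  have "c + (M * 3 + n * 4 + 6) +
    (n * (n * 6 + 11) + M * (n * (n * 32 + 24) + 11) + 8) +
    (n * 5 + K * (q * (W * (n * 15 + 7) + 11) + 11) + 8 +
      (W * 5 + n * (E * (W * 16 + 18) + 7) + 10) + 2) =
    c * 1 + 34 * (1 * 1 * 1) + 14 * (M * 1 * 1) + 27 * (n * 1 * 1) + 6 * (n * n * 1) +
    24 * (M * n * 1) + 32 * (M * n * n) + 5 * (W * 1 * 1) + 18 * (n * E * 1) + 16 * (n * E * W) +
    11 * (K * 1 * 1) + 11 * (q * (K * 1 * 1)) + 7 * (q * (K * W * 1)) + 15 * (q * (K * W * n))"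
    by (simp add: algebra_simps)
  also have "\<dots> \<le> c * B ^ 3 + 34 * B ^ 3 + 14 * B ^ 3 + 27 * B ^ 3 + 6 * B ^ 3 +
    24 * B ^ 3 + 32 * B ^ 3 + 5 * B ^ 3 + 18 * B ^ 3 + 16 * B ^ 3 +
    11 * B ^ 3 + 11 * (q * B ^ 3) + 7 * (q * B ^ 3) + 15 * (q * B ^ 3)"
    using B(1) by (intro add_mono mult_le_mono2 mon B) simp
  also have "\<dots> \<le> (c + 200 + 40 * q) * B ^ 3" by (simp add: algebra_simps)
  finally show ?thesis .
qed

text \<open>Common to both parameters. With \<open>B\<close> the input length times
  \<open>2 ^ q ^ par A\<close>, the bound \<open>B ^ 3\<close> separates into a function of the
  parameter and the cube of the input length.\<close>

lemma fixed_parameter_tractable_Solve: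
  fixes par :: "'f mat \<Rightarrow> nat"
  assumes y: "y \<noteq> rGen"
    and solve: "\<And>A Q r m. (\<And>t r' m'. t \<le> dim_col A * 5 + K A * (q * (q ^ par A * (dim_col A * 15 + 7) + 11) + 11) + 8 +
        (q ^ par A * 5 + dim_col A * (2 ^ q ^ par A * (q ^ par A * 16 + 18) + 7) + 10) + 2 \<Longrightarrow>
        r' 0 = num_bases A \<Longrightarrow> Q t (r', m')) \<Longrightarrow>
      tables (m aMul) (m aFma) (m aNonzero) \<Longrightarrow> constants r \<Longrightarrow>
      r rRows = dim_row A \<Longrightarrow> r rCols = dim_col A \<Longrightarrow> r rEntries = dim_row A + dim_col A + 2 \<Longrightarrow>
      r rPos = 0 \<Longrightarrow> valid (m aIn) \<Longrightarrow> valid (m aGen) \<Longrightarrow> m aWord = (\<lambda>_. 0) \<Longrightarrow> m aCount = (\<lambda>_. 0) \<Longrightarrow>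
      (\<And>i. i < dim_row A \<Longrightarrow> rd (m aIn) (dim_row A + dim_col A + 2) (dim_col A) i = matrix_row A i) \<Longrightarrow>
      elim_state (dim_col A) (matrix_row A) (dim_row A) m \<Longrightarrow> wp (Solve x y a f) Q (r, m)"
    and K: "\<And>A. K A \<le> dim_row A + dim_col A"
  shows "fixed_parameter_tractable (matrix_word code) par num_bases"
proof -
  define c where "c = 3 * (q * q) + 3 * (q * (q * q)) + 3 * q + 8"
  let ?C = "c + 200 + 40 * q" and ?p = "Prepare ;; Solve x y a f"
  have "\<exists>t. computes_in_steps ?p (matrix_word code A) t (num_bases A) \<and>
      t \<le> ?C * 2 ^ (3 * q ^ par A) * length (matrix_word code A) ^ 3" for A
  proof -
    let ?N = "length (matrix_word code A)" and ?W = "q ^ par A"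
    \<comment> \<open>The unary dimensions bound the numbers of rows and columns by the input length
      even if the matrix has no entries.\<close>
    have N: "dim_row A + dim_col A + 1 \<le> ?N" by (simp add: matrix_word_def)
    have pow: "?W \<le> 2 ^ ?W" "1 \<le> (2 :: nat) ^ ?W" by (simp_all add: less_imp_le less_exp)
    have le_N: "z \<le> ?N * 2 ^ ?W" if "z \<le> ?N" for z
      using mult_le_mono[OF that pow(2)] by simp
    have le_W: "z \<le> ?N * 2 ^ ?W" if "z \<le> 2 ^ ?W" for z
      using mult_le_mono[of 1 ?N z "2 ^ ?W"] N that by simp
    have bounds: "1 \<le> ?N * 2 ^ ?W" "dim_row A \<le> ?N * 2 ^ ?W" "dim_col A \<le> ?N * 2 ^ ?W"
      "K A \<le> ?N * 2 ^ ?W" "?W \<le> ?N * 2 ^ ?W" "2 ^ ?W \<le> ?N * 2 ^ ?W"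
      using le_N[of 1] le_N[of "dim_row A"] le_N[of "dim_col A"] le_N[of "K A"] le_W[of ?W]
        le_W[of "2 ^ ?W"] N K[of A] pow(1) by linarith+
    have "wp ?p (\<lambda>t s. fst s 0 = num_bases A \<and> t \<le> ?C * (?N * 2 ^ ?W) ^ 3) (initial_state (matrix_word code A))"
      unfolding wp_Seq
    proof (rule wp_Prepare, rule solve[where A = A], goal_cases)
      case (1 t r m u r' m')
      have "t + u \<le> ?C * (?N * 2 ^ ?W) ^ 3"
        by (rule order_trans[OF add_mono[OF 1(1) 1(14)]], unfold c_def[symmetric], rule time_bound) (fact bounds)+
      then show ?case using 1(15) by simp
    qed
    moreover have "(?N * 2 ^ ?W) ^ 3 = 2 ^ (3 * ?W) * ?N ^ 3"
      by (simp add: power_mult_distrib power_mult[symmetric] mult.commute)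
    ultimately show ?thesis
      unfolding computes_in_steps_def wp_def by (auto simp: mult.assoc)
  qed
  then show ?thesis
    unfolding fixed_parameter_tractable_def using computable_double_exp by blast
qed

text \<open>The generators of the row space are the original rows selected by \<open>aPivot\<close>.
  They are read in place, since elimination never writes to \<open>aIn\<close>.\<close>

lemma fpt_rank: "fixed_parameter_tractable (matrix_word code) matroid_rank num_bases"
proof (rule fixed_parameter_tractable_Solve[where x = rEntries and y = rRows and a = aIn and f = aPivot
      and K = dim_row], goal_cases)
  case (2 A Q r m)
  let ?U = "{l. l < dim_row A \<and> m aPivot l \<noteq> 0}"
  note fin = elim_inv_final[OF 2(13)]
  have span: "span_of (rd (m aIn) (dim_row A + dim_col A + 2) (dim_col A)) ?U = span_of (matrix_row A) ?U"
    by (rule span_of_cong) (use 2(12) in simp)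
  have card: "card (span_of (matrix_row A) ?U) = q ^ card ?U" using 2(13) by (simp add: elim_inv_def q_eq)
  show ?case
    by (rule wp_Solve[where L = ?U and W = "q ^ matroid_rank A" and K = "dim_row A"])
      (use 2 fin span card in auto)
qed auto

text \<open>The first argument of \<^term>\<open>Solve\<close> is a register holding 0; \<open>rPos\<close> has not been used before.\<close>

lemma fpt_nullity: "fixed_parameter_tractable (matrix_word code) matroid_nullity num_bases"
proof (rule fixed_parameter_tractable_Solve[where x = rPos and y = rCols and a = aGen and f = aAlive
      and K = dim_col], goal_cases)
  case (2 A Q r m)
  let ?L = "{l. l < dim_col A \<and> m aAlive l \<noteq> 0}"
  note fin = elim_inv_final[OF 2(13)]
  have card: "card (span_of (rd (m aGen) 0 (dim_col A)) ?L) = q ^ card ?L"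
    using 2(13) by (simp add: elim_inv_def q_eq)
  show ?case
    by (rule wp_Solve[where L = ?L and W = "q ^ matroid_nullity A" and K = "dim_col A"])
      (use 2 fin card in auto)
qed auto

end

theorem theorem5:
  fixes code :: "'f::{field, finite} \<Rightarrow> nat"
  assumes "bij_betw code UNIV {0..<card (UNIV :: 'f set)}"
  shows "fixed_parameter_tractable (matrix_word code) matroid_rank num_bases \<and>
    fixed_parameter_tractable (matrix_word code) matroid_nullity num_bases"
proof -
  interpret field_coding code "card (UNIV :: 'f set)" using assms by unfold_locales
  show ?thesis using fpt_rank fpt_nullity by blast
qed

end
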